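(* Let $\mathcal{H}$ and $\mathcal{U}$ be real Hilbert spaces and $L:\mathcal{H}\to\mathcal{U}$ a nonzero bounded linear operator with operator norm $\|L\|$ and adjoint $L^*$. Let $f\in\Gamma_0(\mathcal{H})$ be a smooth $\rho$-strongly convex function for some $\rho>0$, so that the function $$\hat{f}:x\mapsto f(x)-\frac{\rho}{2\|L\|^2}\|Lx\|_{\mathcal{U}}^2,$$ which belongs to $\Gamma_0(\mathcal{H})$, is $\kappa$-smooth for some $\kappa>0$. Let $\beta\in(0,1)$ and let $T:=\nabla\psi:\mathcal{U}\to\mathcal{U}$, where $\psi\in\Gamma_0(\mathcal{U})$ is a Fréchet differentiable convex function with $\beta^{-1}$-Lipschitz continuous gradient. Let $\sigma,\tau>0$ satisfy (i) $\sigma\le\dfrac{\rho\beta}{\|L\|^2(1-\beta)}$, (ii) $\tau\Big(\sigma\|L\|^2+\dfrac{\kappa}{2}\Big)<1$. Define $$g:=\Big(\sigma+\frac{\rho}{\|L\|^2}\Big)\Big(\psi^*-\frac12\|\cdot\|_{\mathcal{U}}^2\Big),\qquad \check{g}:=g+\frac{\rho}{2\|L\|^2}\|\cdot\|_{\mathcal{U}}^2\in\Gamma_0(\mathcal{U}),$$ which satisfy $f+g\circ L=\hat{f}+\check{g}\circ L\in\Gamma_0(\mathcal{H})$. Then, for arbitrary $(x_0,u_0)\in\mathcal{H}\times\mathcal{U}$, the sequences $(x_k)_{k\in\mathbb{N}}\subset\mathcal{H}$ and $(u_k)_{k\in\mathbb{N}}\subset\mathcal{U}$ generated by $$\tilde{u}_{k+1}:=u_k+\sigma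 Lx_k,$$ $$u_{k+1}:=\tilde{u}_{k+1}-\sigma T\Big(\Big(\sigma+\frac{\rho}{\|L\|^2}\Big)^{-1}\tilde{u}_{k+1}\Big),$$ $$x_{k+1}:=\Big(\mathrm{Id}+\frac{\tau\rho}{\|L\|^2}L^*L\Big)x_k-\tau\nabla f(x_k)-\tau L^*(2u_{k+1}-u_k)$$ converge weakly to solutions $\hat{x}\in\mathcal{H}$ and $\hat{u}\in\mathcal{U}$ of the following primal and dual problems, respectively: $$\min_{x\in\mathcal{H}}\ f(x)+g(Lx),\qquad \min_{u\in\mathcal{U}}\ \hat{f}^*(-L^*u)+\check{g}^*(u),$$ provided that such solutions exist.
   Context: For a real Hilbert space $\mathcal{X}$, $\Gamma_0(\mathcal{X})$ is the set of proper lower semicontinuous convex functions $\mathcal{X}\to(-\infty,+\infty]$. A function is smooth ($\kappa$-smooth) if it is real-valued and differentiable on the whole space with Lipschitz continuous ($\kappa$-Lipschitz continuous) gradient. $f$ is $\rho$-strongly convex if $f-\frac{\rho}{2}\|\cdot\|^2$ is convex. The Fenchel conjugate is $h^*(x):=\sup_{y}[\langle x,y\rangle-h(y)]$. An operator $T=\nabla\psi$ with $\psi$ convex and $\beta^{-1}$-smooth, $\beta\in(0,1)$, is called a monotone Lipschitz-gradient (MoL-Grad) denoiser. $\mathrm{Id}$ is the identity operator and $\mathbb{N}$ denotes the nonnegative integers.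
   Formalization: "Provided that such solutions exist" is read as existence of primal and dual solutions with zero duality gap (convergence can fail with a gap), and f+g∘L ∈ Γ₀ is claimed only when f+g∘L is not identically +∞ (it can be otherwise). *)

theory Defs
  imports "HOL-Analysis.Analysis"
begin

text \<open>
  Real Hilbert spaces are types of sort \<open>{real_inner, complete_space}\<close>. Functions with values in
  \<open>(-\<infinity>, +\<infinity>]\<close> are functions into \<^typ>\<open>ereal\<close>; real-valued functions are embedded by \<^const>\<open>ereal\<close>.
\<close>

definition proper_fun :: "('a \<Rightarrow> ereal) \<Rightarrow> bool" where
  "proper_fun F \<longleftrightarrow> (\<forall>x. F x \<noteq> -\<infinity>) \<and> (\<exists>x. F x \<noteq> \<infinity>)"

definition lsc_fun :: "('a::topological_space \<Rightarrow> ereal) \<Rightarrow> bool" where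
  "lsc_fun F \<longleftrightarrow> (\<forall>a::real. closed {x. F x \<le> ereal a})"

text \<open>
  Convexity is convexity of the epigraph. Unlike the inequality between function values, this does
  not depend on the value that \<^typ>\<open>ereal\<close> gives to \<open>\<infinity> + -\<infinity>\<close>.
\<close>

definition convex_fun :: "('a::real_vector \<Rightarrow> ereal) \<Rightarrow> bool" where
  "convex_fun F \<longleftrightarrow> convex {(x, r::real). F x \<le> ereal r}"

definition Gamma0 :: "('a::real_normed_vector \<Rightarrow> ereal) set" where
  "Gamma0 = {F. proper_fun F \<and> lsc_fun F \<and> convex_fun F}"

definition fenchel_conj :: "('a::real_inner \<Rightarrow> ereal) \<Rightarrow> 'a \<Rightarrow> ereal" where
  "fenchel_conj F x = (SUP y. ereal (x \<bullet> y) - F y)"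

text \<open>
  The gradient is the Riesz representative of the Frechet derivative. On a Hilbert space it exists
  at every point of differentiability.
\<close>

definition gradient :: "('a::real_inner \<Rightarrow> real) \<Rightarrow> 'a \<Rightarrow> 'a" where
  "gradient f x = (THE d. GDERIV f x :> d)"

definition lip_smooth :: "real \<Rightarrow> ('a::real_inner \<Rightarrow> real) \<Rightarrow> bool" where
  "lip_smooth k f \<longleftrightarrow> (\<forall>x. f differentiable (at x)) \<and> k-lipschitz_on UNIV (gradient f)"

definition strongly_convex :: "real \<Rightarrow> ('a::real_inner \<Rightarrow> real) \<Rightarrow> bool" where
  "strongly_convex \<rho> f \<longleftrightarrow> convex_on UNIV (\<lambda>x. f x - \<rho> / 2 * (norm x)\<^sup>2)"

definition weakly_converges :: "(nat \<Rightarrow> 'a::real_inner) \<Rightarrow> 'a \<Rightarrow> bool" where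
  "weakly_converges x l \<longleftrightarrow> (\<forall>y. (\<lambda>k. x k \<bullet> y) \<longlonglongrightarrow> l \<bullet> y)"

definition minimizer :: "('a \<Rightarrow> ereal) \<Rightarrow> 'a \<Rightarrow> bool" where
  "minimizer F x \<longleftrightarrow> is_arg_min F (\<lambda>_. True) x"

end

theory Submission
  imports Defs
begin

text \<open>
  Put \<open>s = \<sigma> + \<rho> / \<parallel>L\<parallel>\<^sup>2\<close>. Moving the quadratic \<open>\<rho> / (2 \<parallel>L\<parallel>\<^sup>2) \<parallel>L x\<parallel>\<^sup>2\<close> from \<open>f\<close> to \<open>g\<close> keeps the objective and
  makes both terms convex: \<open>fhat\<close> because \<open>f\<close> is \<open>\<rho>\<close>-strongly convex, and \<open>gcheck = s \<psi>\<^sup>* - \<sigma> / 2 \<parallel>\<cdot>\<parallel>\<^sup>2\<close>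
  because \<open>\<psi>\<^sup>*\<close> is \<open>\<beta>\<close>-strongly convex and \<open>\<sigma> \<le> s \<beta>\<close>. The denoiser is then a proximity operator: its graph
  parametrises the subdifferential of \<open>gcheck\<close> by the pairs \<open>(T y, s y - \<sigma> T y)\<close>
  (\<open>G_subgradient\<close>), and the iteration is the primal-dual algorithm of Condat and Vu for
  \<open>fhat + gcheck \<circ> L\<close>, with an explicit gradient step on \<open>fhat\<close>.

  Solutions are handled through the saddle equations \<open>\<nabla>fhat x = - L\<^sup>* u\<close>, \<open>L x = T ((u + \<sigma> L x) / s)\<close>.
  A primal-dual pair without duality gap satisfies them, by equality in the Fenchel--Young
  inequalities (\<open>no_duality_gap_imp_saddle\<close>), and every solution of them consists of minimisers of both
  problems, by weak duality (\<open>saddle_imp_minimizers\<close>).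

  On the product space, the metric with blocks \<open>1 / \<tau>\<close>, \<open>L\<^sup>*\<close>, \<open>L\<close>, \<open>1 / \<sigma>\<close> turns the iteration into a
  forward-backward step for the sum of a cocoercive and a monotone operator. The squared distance to any
  saddle point decreases, with a gain proportional to \<open>\<parallel>z k - z (Suc k)\<parallel>\<^sup>2\<close> (\<open>fejer_step\<close>); the
  condition on \<open>\<tau>\<close> makes the gain positive. Hence the iterates are bounded and the increments tend to
  zero. Minty's device, applied to weak limits, shows that weak cluster points are saddle points
  (\<open>weak_cluster_point_in_saddle\<close>), and the argument of Opial leaves only one of them
  (\<open>opial\<close>). Weak compactness of bounded sets in a possibly nonseparable Hilbert space comes from
  Tychonoff's theorem and the Riesz representation, with filters in place of subsequences.
\<close>

section \<open>Hilbert space preliminaries\<close>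

text \<open>The representing vector is the minimiser of \<open>\<parallel>y\<parallel>\<^sup>2 / 2 - \<phi> y\<close>: the parallelogram identity makes
  every minimising sequence Cauchy, and stationarity of the minimum is the assertion.\<close>

lemma riesz_representation:
  fixes \<phi> :: "'a::{real_inner,complete_space} \<Rightarrow> real"
  assumes "bounded_linear \<phi>"
  shows "\<exists>l. \<forall>y. \<phi> y = y \<bullet> l"
proof -
  interpret \<phi>: bounded_linear \<phi> by fact
  define J where "J y = (y \<bullet> y) / 2 - \<phi> y" for y
  obtain K where K: "\<And>y. norm (\<phi> y) \<le> norm y * K" using \<phi>.bounded by blast
  have J_lower: "J y \<ge> - K\<^sup>2 / 2" for y
  proof -
    have "\<phi> y \<le> norm y * K" using K[of y] by simp
    moreover have "(norm y - K)\<^sup>2 \<ge> 0" by simp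
    ultimately show ?thesis
      unfolding J_def dot_square_norm by (simp add: power2_eq_square algebra_simps)
  qed
  then have bdd: "bdd_below (range J)" by (meson bdd_belowI2)
  define m where "m = Inf (range J)"
  have m_le: "m \<le> J y" for y unfolding m_def by (rule cINF_lower[OF bdd]) simp
  have ex: "\<exists>y. J y < m + 1 / Suc n" for n
    using cInf_lessD[of "range J" "m + 1 / Suc n"] unfolding m_def by auto
  then obtain s where s: "\<And>n. J (s n) < m + 1 / Suc n" by metis
  have parallelogram: "norm (a - b)^2 = 4 * (J a + J b - 2 * J ((1/2) *\<^sub>R (a + b)))" for a b
    unfolding J_def power2_norm_eq_inner
    by (simp add: \<phi>.add \<phi>.scaleR inner_add_left inner_add_right inner_diff_left inner_diff_right
        inner_commute field_simps)
  have "Cauchy s"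
  proof (rule metric_CauchyI)
    fix e :: real assume e: "e > 0"
    obtain N where N: "8 / e\<^sup>2 < real N" using reals_Archimedean2 by blast
    have near: "J (s n) < m + e\<^sup>2 / 8" if "n \<ge> N" for n
    proof -
      have "8 / e\<^sup>2 < real (Suc n)" using N that by linarith
      then have "1 / real (Suc n) < e\<^sup>2 / 8" using e by (simp add: field_simps)
      then show ?thesis using s[of n] by linarith
    qed
    have "dist (s i) (s j) < e" if "i \<ge> N" "j \<ge> N" for i j
    proof -
      have "norm (s i - s j)^2 < e\<^sup>2"
        using parallelogram[of "s i" "s j"] near[OF that(1)] near[OF that(2)]
          m_le[of "(1/2) *\<^sub>R (s i + s j)"] by (simp add: field_simps)
      then show ?thesis using e by (simp add: dist_norm power2_less_imp_less)
    qed
    then show "\<exists>M. \<forall>i\<ge>M. \<forall>j\<ge>M. dist (s i) (s j) < e" by blast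
  qed
  then obtain l where l: "s \<longlonglongrightarrow> l" using Cauchy_convergent_iff convergent_def by blast
  have "(\<lambda>n. J (s n)) \<longlonglongrightarrow> J l"
    unfolding J_def by (intro tendsto_intros l \<phi>.tendsto) simp
  moreover have "(\<lambda>n. m + 1 / real (Suc n)) \<longlonglongrightarrow> m + 0"
    by (intro tendsto_add tendsto_const LIMSEQ_Suc[OF lim_1_over_n[where 'a = real]])
  ultimately have "J l \<le> m + 0"
    by (rule LIMSEQ_le) (use s less_imp_le in blast)
  then have min: "J l \<le> J y" for y using m_le[of y] by simp
  have "\<phi> y = y \<bullet> l" for y
  proof (rule ccontr)
    define d where "d = \<phi> y - y \<bullet> l"
    assume "\<phi> y \<noteq> y \<bullet> l"
    then have d: "d \<noteq> 0" by (simp add: d_def)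
    then have y: "y \<bullet> y > 0" by (auto simp: d_def \<phi>.zero)
    define t where "t = d / (y \<bullet> y)"
    have "J (l + t *\<^sub>R y) = J l - t * d + t\<^sup>2 * (y \<bullet> y) / 2"
      unfolding J_def d_def
      by (simp add: \<phi>.add \<phi>.scaleR inner_add_left inner_add_right inner_commute
          power2_eq_square field_simps)
    moreover have "t\<^sup>2 * (y \<bullet> y) = t * d" "t * d > 0"
      using y d by (auto simp: t_def power2_eq_square zero_less_mult_iff zero_less_divide_iff)
    ultimately show False using min[of "l + t *\<^sub>R y"] by linarith
  qed
  then show ?thesis by blast
qed

lemma adjoint_hilbert:
  fixes L :: "'a::{real_inner,complete_space} \<Rightarrow> 'b::real_inner"
  assumes "bounded_linear L"
  shows "L x \<bullet> u = x \<bullet> adjoint L u"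
proof -
  have "bounded_linear (\<lambda>x. L x \<bullet> u)" for u
    using assms bounded_linear_inner_left bounded_linear_compose by blast
  then have "\<exists>l. \<forall>x. L x \<bullet> u = x \<bullet> l" for u using riesz_representation by blast
  then have "\<exists>L'. \<forall>x u. L x \<bullet> u = x \<bullet> L' u" by metis
  then show ?thesis unfolding adjoint_def by (rule someI2_ex) blast
qed

lemma adjoint_hilbert':
  fixes L :: "'a::{real_inner,complete_space} \<Rightarrow> 'b::real_inner"
  assumes "bounded_linear L"
  shows "adjoint L u \<bullet> x = u \<bullet> L x"
  using adjoint_hilbert[OF assms, of x u] by (simp add: inner_commute)

lemma norm_adjoint_le:
  fixes L :: "'a::{real_inner,complete_space} \<Rightarrow> 'b::real_inner"
  assumes "bounded_linear L"
  shows "norm (adjoint L u) \<le> onorm L * norm u"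
proof (cases "adjoint L u = 0")
  case True
  then show ?thesis by (simp add: onorm_pos_le[OF assms])
next
  case False
  have "norm (adjoint L u) * norm (adjoint L u) = L (adjoint L u) \<bullet> u"
    by (simp add: adjoint_hilbert[OF assms] dot_square_norm power2_eq_square)
  also have "\<dots> \<le> norm (L (adjoint L u)) * norm u" by (rule norm_cauchy_schwarz)
  also have "\<dots> \<le> (onorm L * norm (adjoint L u)) * norm u"
    by (intro mult_right_mono onorm assms) simp
  finally have "norm (adjoint L u) * norm (adjoint L u) \<le> norm (adjoint L u) * (onorm L * norm u)"
    by (simp add: algebra_simps)
  then show ?thesis using False by simp
qed

lemma bounded_linear_adjoint:
  fixes L :: "'a::{real_inner,complete_space} \<Rightarrow> 'b::real_inner"
  assumes "bounded_linear L"
  shows "bounded_linear (adjoint L)"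
proof (rule bounded_linear_intro[where K = "onorm L"])
  show "adjoint L (u + v) = adjoint L u + adjoint L v" for u v
    by (rule vector_eq_ldot[THEN iffD1])
       (simp add: inner_add_right adjoint_hilbert[OF assms, symmetric])
  show "adjoint L (r *\<^sub>R u) = r *\<^sub>R adjoint L u" for r u
    by (rule vector_eq_ldot[THEN iffD1])
       (simp add: adjoint_hilbert[OF assms, symmetric])
  show "norm (adjoint L u) \<le> norm u * onorm L" for u
    using norm_adjoint_le[OF assms] by (simp add: mult.commute)
qed

section \<open>Weak compactness and the Opial lemma\<close>

text \<open>Weak cluster points are taken along filters instead of subsequences, so that no separability
  or diagonal argument is needed: by Tychonoff's theorem the functionals \<open>y \<mapsto> z i \<bullet> y\<close> have a
  pointwise cluster point, which is bounded and linear and hence represented by a vector.\<close>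

lemma bounded_imp_weak_cluster_point:
  fixes z :: "'i \<Rightarrow> 'a::{real_inner,complete_space}"
  assumes bounded: "\<And>i. norm (z i) \<le> M" and "F0 \<noteq> bot"
  shows "\<exists>F l. F \<noteq> bot \<and> F \<le> F0 \<and> (\<forall>y. ((\<lambda>i. z i \<bullet> y) \<longlongrightarrow> l \<bullet> y) F)"
proof -
  define G where "G i = (\<lambda>y. z i \<bullet> y)" for i
  define C where "C = (PiE UNIV (\<lambda>y. {- (M * norm y)..M * norm y}) :: ('a \<Rightarrow> real) set)"
  have "compactin (product_topology (\<lambda>_. euclidean) UNIV) C"
    unfolding C_def by (subst compactin_PiE) simp
  then have "compact C" by (simp add: euclidean_product_topology)
  have G_bound: "\<bar>G i y\<bar> \<le> M * norm y" for i y
    unfolding G_def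
    by (rule order_trans[OF Cauchy_Schwarz_ineq2]) (simp add: mult_right_mono bounded)
  then have "G i \<in> C" for i by (auto simp: C_def abs_le_iff) (metis minus_le_iff)
  then have "eventually (\<lambda>p. p \<in> C) (filtermap G F0)" by (simp add: eventually_filtermap)
  moreover have "filtermap G F0 \<noteq> bot" using assms(2) by (simp add: filtermap_bot_iff)
  ultimately obtain \<phi> where \<phi>: "\<phi> \<in> C" "inf (nhds \<phi>) (filtermap G F0) \<noteq> bot"
    using \<open>compact C\<close> unfolding compact_filter by blast
  define F where "F = inf (filtercomap G (nhds \<phi>)) F0"
  have "F \<noteq> bot"
  proof
    assume "F = bot"
    then have "eventually (\<lambda>_. False) (inf (filtercomap G (nhds \<phi>)) F0)"
      by (simp add: F_def)
    then obtain P Q where PQ: "eventually P (nhds \<phi>)" "eventually Q F0" "\<And>i. P (G i) \<Longrightarrow> Q i \<Longrightarrow> False"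
      unfolding eventually_inf eventually_filtercomap by blast
    have "eventually (\<lambda>p. \<not> P p) (filtermap G F0)"
      unfolding eventually_filtermap by (rule eventually_mono[OF PQ(2)]) (use PQ(3) in blast)
    then have "eventually (\<lambda>_. False) (inf (nhds \<phi>) (filtermap G F0))"
      unfolding eventually_inf using PQ(1) by blast
    with \<phi>(2) show False by (simp add: trivial_limit_def)
  qed
  moreover have "F \<le> F0" by (simp add: F_def)
  moreover have lim: "((\<lambda>i. z i \<bullet> y) \<longlongrightarrow> \<phi> y) F" for y
  proof -
    have "(G \<longlongrightarrow> \<phi>) F"
      using filterlim_filtercomap[of G "nhds \<phi>"] by (simp add: F_def le_infI1 filterlim_mono)
    moreover have "((\<lambda>p. p y) \<longlongrightarrow> \<phi> y) (nhds \<phi>)"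
    proof (rule topological_tendstoI)
      fix U :: "real set" assume "open U" "\<phi> y \<in> U"
      then show "eventually (\<lambda>p. p y \<in> U) (nhds \<phi>)"
        using open_vimage[OF \<open>open U\<close> continuous_on_product_coordinates[of y]]
        unfolding eventually_nhds by (intro exI[of _ "(\<lambda>p. p y) -` U"]) simp
    qed
    ultimately have "((\<lambda>i. G i y) \<longlongrightarrow> \<phi> y) F" by (rule filterlim_compose[rotated])
    then show ?thesis by (simp add: G_def)
  qed
  moreover have "bounded_linear \<phi>"
  proof (rule bounded_linear_intro[where K = M])
    show "\<phi> (x + y) = \<phi> x + \<phi> y" for x y
      using tendsto_add[OF lim[of x] lim[of y]] lim[of "x + y"] tendsto_unique[OF \<open>F \<noteq> bot\<close>]
      by (simp add: inner_add_right)
    show "\<phi> (r *\<^sub>R x) = r *\<^sub>R \<phi> x" for r x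
      using tendsto_mult_left[OF lim[of x], of r] lim[of "r *\<^sub>R x"] tendsto_unique[OF \<open>F \<noteq> bot\<close>]
      by simp
    show "norm (\<phi> x) \<le> norm x * M" for x
    proof -
      have "\<phi> x \<in> {- (M * norm x)..M * norm x}" using \<phi>(1) by (auto simp: C_def)
      then show ?thesis by (auto simp: abs_le_iff mult.commute)
    qed
  qed
  then obtain l where "\<And>y. \<phi> y = l \<bullet> y"
    using riesz_representation[of \<phi>] by (metis inner_commute)
  ultimately show ?thesis by auto
qed

text \<open>Two weak cluster points \<open>l\<close> and \<open>l'\<close> in \<open>S\<close> coincide: the difference of the convergent sequences
  of squared \<open>P\<close>-distances to \<open>l\<close> and \<open>l'\<close> is affine in \<open>z k\<close> with direction \<open>P (l - l')\<close>, so
  its limits along the two cluster filters agree, which gives \<open>(l - l') \<bullet> P (l - l') = 0\<close>.\<close>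

lemma opial:
  fixes z :: "nat \<Rightarrow> 'a::{real_inner,complete_space}" and P :: "'a \<Rightarrow> 'a"
  assumes lin: "linear P" and sym: "\<And>x y. x \<bullet> P y = P x \<bullet> y"
    and pos: "c > 0" "\<And>d. c * (norm d)\<^sup>2 \<le> d \<bullet> P d"
    and bounded: "\<And>k. norm (z k) \<le> M"
    and conv: "\<And>s. s \<in> S \<Longrightarrow> convergent (\<lambda>k. (z k - s) \<bullet> P (z k - s))"
    and cluster: "\<And>F l. F \<noteq> bot \<Longrightarrow> F \<le> sequentially \<Longrightarrow>
       (\<And>y. ((\<lambda>k. z k \<bullet> y) \<longlongrightarrow> l \<bullet> y) F) \<Longrightarrow> l \<in> S"
  shows "\<exists>l\<in>S. weakly_converges z l"
proof -
  obtain F l where F: "F \<noteq> bot" "F \<le> sequentially" and l: "\<And>y. ((\<lambda>k. z k \<bullet> y) \<longlongrightarrow> l \<bullet> y) F"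
    using bounded_imp_weak_cluster_point[of z M sequentially] bounded by auto
  have "l \<in> S" using cluster[OF F l] .
  have "(\<lambda>k. z k \<bullet> y) \<longlonglongrightarrow> l \<bullet> y" for y
  proof (rule ccontr)
    assume "\<not> (\<lambda>k. z k \<bullet> y) \<longlonglongrightarrow> l \<bullet> y"
    then obtain e where e: "e > 0" "\<not> eventually (\<lambda>k. dist (z k \<bullet> y) (l \<bullet> y) < e) sequentially"
      by (auto simp: tendsto_iff)
    define F1 where "F1 = inf sequentially (principal {k. \<not> dist (z k \<bullet> y) (l \<bullet> y) < e})"
    have "F1 \<noteq> bot"
      using e(2) by (auto simp: F1_def trivial_limit_def eventually_inf_principal)
    then obtain F' l' where F': "F' \<noteq> bot" "F' \<le> F1" and l': "\<And>y. ((\<lambda>k. z k \<bullet> y) \<longlongrightarrow> l' \<bullet> y) F'"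
      using bounded_imp_weak_cluster_point[of z M F1] bounded by auto
    have F'_le: "F' \<le> sequentially" using F'(2) by (simp add: F1_def)
    have "l' \<in> S" using cluster[OF F'(1) F'_le l'] .
    obtain a b where ab: "(\<lambda>k. (z k - l) \<bullet> P (z k - l)) \<longlonglongrightarrow> a" "(\<lambda>k. (z k - l') \<bullet> P (z k - l')) \<longlonglongrightarrow> b"
      using conv[OF \<open>l \<in> S\<close>] conv[OF \<open>l' \<in> S\<close>] by (auto simp: convergent_def)
    define h where "h k = z k \<bullet> P (l - l')" for k
    have "h = (\<lambda>k. ((z k - l') \<bullet> P (z k - l') - (z k - l) \<bullet> P (z k - l) + (l \<bullet> P l - l' \<bullet> P l')) / 2)"
    proof
      fix k
      have "P (z k) \<bullet> l = z k \<bullet> P l" "P (z k) \<bullet> l' = z k \<bullet> P l'" using sym by simp_all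
      then show "h k = ((z k - l') \<bullet> P (z k - l') - (z k - l) \<bullet> P (z k - l) + (l \<bullet> P l - l' \<bullet> P l')) / 2"
        unfolding h_def
        by (simp add: linear_diff[OF lin] inner_diff_left inner_diff_right inner_commute)
    qed
    then have h: "h \<longlonglongrightarrow> (b - a + (l \<bullet> P l - l' \<bullet> P l')) / 2"
      by (auto intro!: tendsto_intros ab)
    have "l \<bullet> P (l - l') = (b - a + (l \<bullet> P l - l' \<bullet> P l')) / 2"
      using tendsto_unique[OF F(1) l[of "P (l - l')"]] tendsto_mono[OF F(2) h]
      unfolding h_def by blast
    moreover have "l' \<bullet> P (l - l') = (b - a + (l \<bullet> P l - l' \<bullet> P l')) / 2"
      using tendsto_unique[OF F'(1) l'[of "P (l - l')"]] tendsto_mono[OF F'_le h]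
      unfolding h_def by blast
    ultimately have "(l - l') \<bullet> P (l - l') = 0" by (simp add: inner_diff_left)
    then have "c * (norm (l - l'))\<^sup>2 \<le> 0" using pos(2)[of "l - l'"] by simp
    then have "l = l'" using pos(1) by (simp add: mult_le_0_iff)
    then have "eventually (\<lambda>k. dist (z k \<bullet> y) (l \<bullet> y) < e) F'"
      using l'[of y] e(1) by (simp add: tendsto_iff)
    moreover have "eventually (\<lambda>k. \<not> dist (z k \<bullet> y) (l \<bullet> y) < e) F1"
      by (simp add: F1_def eventually_inf_principal)
    then have "eventually (\<lambda>k. \<not> dist (z k \<bullet> y) (l \<bullet> y) < e) F'"
      using F'(2) filter_leD by blast
    ultimately have "eventually (\<lambda>_. False) F'" by eventually_elim simp
    then show False using F'(1) by (simp add: trivial_limit_def)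
  qed
  then show ?thesis using \<open>l \<in> S\<close> by (auto simp: weakly_converges_def)
qed

section \<open>Smooth convex functions\<close>

lemma gradient_eqI:
  assumes "GDERIV f x :> d"
  shows "gradient f x = d"
  unfolding gradient_def
proof (rule the_equality)
  show "GDERIV f x :> d" by fact
next
  fix e assume "GDERIV f x :> e"
  then have "(\<lambda>h. h \<bullet> e) = (\<lambda>h. h \<bullet> d)"
    using assms has_derivative_unique unfolding gderiv_def by blast
  then have "h \<bullet> e = h \<bullet> d" for h by meson
  then show "e = d" by (metis vector_eq_ldot)
qed

lemma GDERIV_gradient:
  fixes f :: "'a::{real_inner,complete_space} \<Rightarrow> real"
  assumes "f differentiable (at x)"
  shows "GDERIV f x :> gradient f x"
proof -
  obtain f' where f': "(f has_derivative f') (at x)"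
    using assms by (auto simp: differentiable_def)
  then obtain d where "\<And>h. f' h = h \<bullet> d"
    using riesz_representation has_derivative_bounded_linear by blast
  then have "f' = (\<lambda>h. h \<bullet> d)" by blast
  then have "GDERIV f x :> d" using f' by (simp add: gderiv_def)
  then show ?thesis using gradient_eqI by blast
qed

lemma lip_smooth_GDERIV:
  fixes f :: "'a::{real_inner,complete_space} \<Rightarrow> real"
  assumes "lip_smooth k f"
  shows "GDERIV f x :> gradient f x"
  using assms GDERIV_gradient unfolding lip_smooth_def by blast

lemma lip_smooth_norm_le:
  assumes "lip_smooth k f"
  shows "norm (gradient f x - gradient f y) \<le> k * norm (x - y)"
  using assms unfolding lip_smooth_def lipschitz_on_def dist_norm by auto

lemma lip_smooth_continuous_on:
  assumes "lip_smooth k f"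
  shows "continuous_on S f"
  using assms unfolding lip_smooth_def
  by (meson continuous_at_imp_continuous_on differentiable_imp_continuous_within)

lemma has_real_derivative_along_line:
  fixes f :: "'a::{real_inner,complete_space} \<Rightarrow> real"
  assumes "lip_smooth k f"
  shows "((\<lambda>t. f (x + t *\<^sub>R d)) has_real_derivative gradient f (x + t *\<^sub>R d) \<bullet> d) (at t)"
proof -
  have "(f has_derivative (\<lambda>h. h \<bullet> gradient f (x + t *\<^sub>R d))) (at (x + t *\<^sub>R d))"
    using lip_smooth_GDERIV[OF assms] by (simp add: gderiv_def)
  moreover have "((\<lambda>t. x + t *\<^sub>R d) has_derivative (\<lambda>h. h *\<^sub>R d)) (at t)"
    by (auto intro!: derivative_eq_intros)
  ultimately have "((\<lambda>t. f (x + t *\<^sub>R d)) has_derivative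
      (\<lambda>h. (h *\<^sub>R d) \<bullet> gradient f (x + t *\<^sub>R d))) (at t)"
    by (rule has_derivative_compose[rotated])
  then show ?thesis
    unfolding has_field_derivative_def
    by (rule has_derivative_eq_rhs) (auto simp: inner_commute mult.commute)
qed

text \<open>Along the segment from \<open>x\<close> to \<open>x + d\<close> the defect of the quadratic bound has nonpositive
  derivative, by the Lipschitz estimate for the gradient.\<close>

lemma descent_lemma:
  fixes f :: "'a::{real_inner,complete_space} \<Rightarrow> real"
  assumes "lip_smooth k f"
  shows "f (x + d) \<le> f x + gradient f x \<bullet> d + k / 2 * (norm d)\<^sup>2"
proof -
  define \<phi> where "\<phi> t = f (x + t *\<^sub>R d) - t * (gradient f x \<bullet> d) - k / 2 * t\<^sup>2 * (norm d)\<^sup>2" for t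
  have "\<phi> 1 \<le> \<phi> 0"
  proof (rule DERIV_nonpos_imp_nonincreasing[of 0 1 \<phi>])
    show "(0::real) \<le> 1" by simp
    fix t :: real assume t: "0 \<le> t" "t \<le> 1"
    let ?D = "gradient f (x + t *\<^sub>R d) \<bullet> d - gradient f x \<bullet> d - k * t * (norm d)\<^sup>2"
    have "(\<phi> has_real_derivative ?D) (at t)"
      unfolding \<phi>_def
      by (rule derivative_eq_intros has_real_derivative_along_line[OF assms] refl | simp)+
    moreover have "?D \<le> 0"
    proof -
      have "gradient f (x + t *\<^sub>R d) \<bullet> d - gradient f x \<bullet> d
          \<le> norm (gradient f (x + t *\<^sub>R d) - gradient f x) * norm d"
        by (metis inner_diff_left norm_cauchy_schwarz)
      also have "\<dots> \<le> (k * norm (t *\<^sub>R d)) * norm d"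
        using lip_smooth_norm_le[OF assms, of "x + t *\<^sub>R d" x] by (intro mult_right_mono) auto
      also have "\<dots> = k * t * (norm d)\<^sup>2" using t by (simp add: power2_eq_square)
      finally show ?thesis by simp
    qed
    ultimately show "\<exists>y. (\<phi> has_real_derivative y) (at t) \<and> y \<le> 0" by blast
  qed
  then show ?thesis by (simp add: \<phi>_def)
qed

lemma convex_gradient_inequality:
  fixes f :: "'a::{real_inner,complete_space} \<Rightarrow> real"
  assumes "convex_on UNIV f" and smooth: "lip_smooth k f"
  shows "f x + gradient f x \<bullet> (y - x) \<le> f y"
proof -
  have "convex_on UNIV (\<lambda>t. f (x + t *\<^sub>R (y - x)))"
  proof (rule convex_onI)
    fix t a b :: real assume t: "0 < t" "t < 1"
    have "x + ((1 - t) *\<^sub>R a + t *\<^sub>R b) *\<^sub>R (y - x)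
        = (1 - t) *\<^sub>R (x + a *\<^sub>R (y - x)) + t *\<^sub>R (x + b *\<^sub>R (y - x))"
      by (simp add: algebra_simps)
    then show "f (x + ((1 - t) *\<^sub>R a + t *\<^sub>R b) *\<^sub>R (y - x))
        \<le> (1 - t) * f (x + a *\<^sub>R (y - x)) + t * f (x + b *\<^sub>R (y - x))"
      using convex_onD[OF assms(1), of t "x + a *\<^sub>R (y - x)" "x + b *\<^sub>R (y - x)"] t by simp
  qed simp
  moreover have "((\<lambda>t. f (x + t *\<^sub>R (y - x))) has_real_derivative gradient f x \<bullet> (y - x)) (at 0)"
    using has_real_derivative_along_line[OF smooth, of x "y - x" 0] by simp
  ultimately have "gradient f x \<bullet> (y - x) * (1 - 0) \<le> f (x + 1 *\<^sub>R (y - x)) - f (x + 0 *\<^sub>R (y - x))"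
    by (intro convex_on_imp_above_tangent[of UNIV]) auto
  then show ?thesis by simp
qed

text \<open>The Baillon--Haddad theorem. In the strengthened gradient inequality, a gradient step of length
  \<open>1 / k\<close> from \<open>y\<close>, for the function tilted by \<open>- gradient f x\<close>, gains the quadratic term by the
  descent lemma; cocoercivity is the sum of this inequality with its mirror image.\<close>

lemma gradient_cocoercive:
  fixes f :: "'a::{real_inner,complete_space} \<Rightarrow> real"
  assumes convex: "convex_on UNIV f" and smooth: "lip_smooth k f" and k: "k > 0"
  shows "(norm (gradient f x - gradient f y))\<^sup>2 / k \<le> (gradient f x - gradient f y) \<bullet> (x - y)"
proof -
  have strengthened: "f x + gradient f x \<bullet> (y - x) + (norm (gradient f y - gradient f x))\<^sup>2 / (2 * k) \<le> f y"
    for x y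
  proof -
    define e where "e = gradient f y - gradient f x"
    define d where "d = - (1 / k) *\<^sub>R e"
    have "f x + gradient f x \<bullet> (y + d - x) \<le> f (y + d)"
      by (rule convex_gradient_inequality[OF convex smooth])
    also have "\<dots> \<le> f y + gradient f y \<bullet> d + k / 2 * (norm d)\<^sup>2"
      by (rule descent_lemma[OF smooth])
    finally have "f x + gradient f x \<bullet> (y - x) \<le> f y + e \<bullet> d + k / 2 * (norm d)\<^sup>2"
      by (simp add: e_def algebra_simps inner_diff_right inner_add_right inner_diff_left)
    moreover have "e \<bullet> d + k / 2 * (norm d)\<^sup>2 = - ((norm e)\<^sup>2 / (2 * k))"
      using k unfolding d_def power2_norm_eq_inner by (simp add: field_simps)
    ultimately show ?thesis unfolding e_def[symmetric] by linarith
  qed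
  have "norm (gradient f y - gradient f x) = norm (gradient f x - gradient f y)"
    by (rule norm_minus_commute)
  then show ?thesis
    using strengthened[of x y] strengthened[of y x]
    by (simp add: algebra_simps inner_diff_right inner_diff_left)
qed

lemma gradient_eq_of_minimum:
  fixes f :: "'a::{real_inner,complete_space} \<Rightarrow> real"
  assumes smooth: "lip_smooth k f" and k: "k > 0"
    and min: "\<And>y. f x + p \<bullet> (y - x) \<le> f y"
  shows "gradient f x = p"
proof (rule ccontr)
  assume ne: "gradient f x \<noteq> p"
  define e where "e = gradient f x - p"
  define d where "d = - (1 / k) *\<^sub>R e"
  have "f x + p \<bullet> d \<le> f x + gradient f x \<bullet> d + k / 2 * (norm d)\<^sup>2"
    using min[of "x + d"] descent_lemma[OF smooth, of x d] by simp
  then have "0 \<le> e \<bullet> d + k / 2 * (norm d)\<^sup>2" by (simp add: e_def inner_diff_left)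
  also have "\<dots> = - (norm e)\<^sup>2 / (2 * k)"
    using k unfolding d_def power2_norm_eq_inner by (simp add: field_simps)
  finally have "(norm e)\<^sup>2 \<le> 0" using k by (simp add: field_simps zero_le_divide_iff)
  then show False using ne by (simp add: e_def)
qed

text \<open>Maximality of the monotone operator \<open>gradient f\<close>, by Minty's device: testing with a point at
  distance proportional to the discrepancy makes the Lipschitz error of second order.\<close>

lemma gradient_eq_of_monotone:
  fixes f :: "'a::{real_inner,complete_space} \<Rightarrow> real"
  assumes smooth: "lip_smooth k f" and k: "k > 0"
    and mono: "\<And>y. 0 \<le> (p - gradient f y) \<bullet> (x - y)"
  shows "gradient f x = p"
proof (rule ccontr)
  assume ne: "gradient f x \<noteq> p"
  define e where "e = p - gradient f x"
  define t where "t = 1 / (2 * k)"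
  have t: "t > 0" using k by (simp add: t_def)
  define D where "D = gradient f x - gradient f (x + t *\<^sub>R e)"
  have "(norm e)\<^sup>2 > 0" using ne by (simp add: e_def)
  have "norm D \<le> k * (t * norm e)"
    using lip_smooth_norm_le[OF smooth, of x "x + t *\<^sub>R e"] t by (simp add: D_def)
  then have "norm D * norm e \<le> (k * (t * norm e)) * norm e" by (intro mult_right_mono) auto
  then have "norm D * norm e \<le> (norm e)\<^sup>2 / 2" using k by (simp add: t_def power2_eq_square)
  moreover have "\<bar>D \<bullet> e\<bar> \<le> norm D * norm e" by (rule Cauchy_Schwarz_ineq2)
  moreover have "0 \<le> (e + D) \<bullet> (- (t *\<^sub>R e))"
    using mono[of "x + t *\<^sub>R e"] by (simp add: e_def D_def)
  then have "t * ((norm e)\<^sup>2 + D \<bullet> e) \<le> 0"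
    by (simp add: inner_add_left power2_norm_eq_inner algebra_simps)
  then have "(norm e)\<^sup>2 + D \<bullet> e \<le> 0" using t by (simp add: mult_le_0_iff)
  ultimately show False using \<open>(norm e)\<^sup>2 > 0\<close> by linarith
qed

section \<open>Conjugates with a quadratic removed\<close>

lemma ereal_eq_if_le_reals:
  fixes X Y :: ereal
  assumes "\<And>a::real. X \<le> ereal a \<longleftrightarrow> Y \<le> ereal a"
  shows "X = Y"
proof (rule antisym)
  have *: "A \<le> B" if "\<And>a::real. B \<le> ereal a \<Longrightarrow> A \<le> ereal a" for A B :: ereal
  proof (cases B)
    case MInf
    then have "A = -\<infinity>" using that by (intro ereal_bot) simp
    then show ?thesis by simp
  qed (use that in auto)
  show "X \<le> Y" "Y \<le> X" using * assms by blast+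
qed

lemma ereal_add_le_real_iff: "ereal b + X \<le> ereal a \<longleftrightarrow> X \<le> ereal (a - b)"
  by (cases X) auto

lemma convex_fun_ereal_iff: "convex_fun (\<lambda>x. ereal (f x)) \<longleftrightarrow> convex_on UNIV f"
  unfolding convex_fun_def convex_epigraph[symmetric] epigraph_def
  by (simp add: case_prod_unfold convex_epigraph)

lemma continuous_convex_in_Gamma0:
  fixes f :: "'a::real_normed_vector \<Rightarrow> real"
  assumes "convex_on UNIV f" "continuous_on UNIV f"
  shows "(\<lambda>x. ereal (f x)) \<in> Gamma0"
proof -
  have "closed {x. f x \<le> a}" for a
    by (intro closed_Collect_le assms continuous_on_const)
  then show ?thesis
    using assms(1) by (simp add: Gamma0_def proper_fun_def lsc_fun_def convex_fun_ereal_iff)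
qed

text \<open>The function \<open>s \<psi>\<^sup>* - \<sigma> / 2 \<parallel>\<cdot>\<parallel>\<^sup>2\<close>, written as one supremum of finite values, so that its sublevel
  sets and its epigraph are described by inequalities between reals.\<close>

definition weakened_conj :: "real \<Rightarrow> real \<Rightarrow> ('a::real_inner \<Rightarrow> real) \<Rightarrow> 'a \<Rightarrow> ereal" where
  "weakened_conj s \<sigma> \<psi> u = (SUP y. ereal (s * (u \<bullet> y - \<psi> y) - \<sigma> / 2 * (norm u)\<^sup>2))"

lemma weakened_conj_le_iff:
  "weakened_conj s \<sigma> \<psi> u \<le> ereal a \<longleftrightarrow> (\<forall>y. s * (u \<bullet> y - \<psi> y) - \<sigma> / 2 * (norm u)\<^sup>2 \<le> a)"
  unfolding weakened_conj_def SUP_le_iff by simp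

lemma weakened_conj_ge: "ereal (s * (u \<bullet> y - \<psi> y) - \<sigma> / 2 * (norm u)\<^sup>2) \<le> weakened_conj s \<sigma> \<psi> u"
  unfolding weakened_conj_def by (rule SUP_upper) simp

lemma weakened_conj_not_MInf: "weakened_conj s \<sigma> \<psi> u \<noteq> -\<infinity>"
  using weakened_conj_ge[of s u 0 \<psi> \<sigma>] by auto

lemma weakened_conj_eq:
  assumes "s > 0"
  shows "ereal s * (fenchel_conj (\<lambda>v. ereal (\<psi> v)) u - ereal (1 / 2 * (norm u)\<^sup>2)) + ereal (r / 2 * (norm u)\<^sup>2)
    = weakened_conj s (s - r) \<psi> u" (is "?X = _")
proof (rule ereal_eq_if_le_reals)
  fix a :: real
  let ?F = "fenchel_conj (\<lambda>v. ereal (\<psi> v)) u"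
  let ?b = "(a - r / 2 * (norm u)\<^sup>2) / s + 1 / 2 * (norm u)\<^sup>2"
  have "?X \<le> ereal a \<longleftrightarrow> ?F \<le> ereal ?b"
    using assms by (cases ?F) (auto simp: field_simps)
  also have "\<dots> \<longleftrightarrow> (\<forall>y. u \<bullet> y - \<psi> y \<le> ?b)"
    by (simp add: fenchel_conj_def SUP_le_iff)
  also have "\<dots> \<longleftrightarrow> weakened_conj s (s - r) \<psi> u \<le> ereal a"
    unfolding weakened_conj_le_iff using assms by (simp add: field_simps)
  finally show "?X \<le> ereal a \<longleftrightarrow> weakened_conj s (s - r) \<psi> u \<le> ereal a" .
qed

lemma norm_convex_combination:
  fixes a b :: "'a::real_inner"
  shows "(norm ((1 - t) *\<^sub>R a + t *\<^sub>R b))\<^sup>2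
    = (1 - t) * (norm a)\<^sup>2 + t * (norm b)\<^sup>2 - t * (1 - t) * (norm (a - b))\<^sup>2"
  unfolding power2_norm_eq_inner inner_add_left inner_add_right inner_diff_left inner_diff_right
    inner_scaleR_left inner_scaleR_right inner_commute[of b a]
  by algebra

text \<open>Since \<open>\<psi>\<close> has a \<open>1 / \<beta>\<close>-Lipschitz gradient, \<open>\<psi>\<^sup>*\<close> is \<open>\<beta>\<close>-strongly convex, so removing \<open>\<sigma> / 2 \<parallel>\<cdot>\<parallel>\<^sup>2\<close>
  from \<open>s \<psi>\<^sup>*\<close> leaves a convex function as long as \<open>\<sigma> \<le> s \<beta>\<close>. In the supremum at the intermediate point,
  each \<open>y\<close> is compared with two points, displaced from \<open>y\<close> by multiples of \<open>\<beta> (u1 - u2)\<close> whose weighted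
  sum is \<open>0\<close>: the first order terms of \<open>\<psi>\<close> then cancel.\<close>

lemma convex_weakened_conj:
  fixes \<psi> :: "'a::{real_inner,complete_space} \<Rightarrow> real"
  assumes smooth: "lip_smooth (1 / \<beta>) \<psi>" and \<beta>: "\<beta> > 0" and s: "s > 0" and \<sigma>: "\<sigma> \<le> s * \<beta>"
  shows "convex_fun (weakened_conj s \<sigma> \<psi>)"
  unfolding convex_fun_def convex_alt
proof (intro ballI allI impI, elim conjE)
  fix p1 p2 :: "'a \<times> real" and t :: real
  assume p: "p1 \<in> {(x, r). weakened_conj s \<sigma> \<psi> x \<le> ereal r}"
    "p2 \<in> {(x, r). weakened_conj s \<sigma> \<psi> x \<le> ereal r}" and t: "0 \<le> t" "t \<le> 1"
  obtain u1 r1 u2 r2 where p_eq: "p1 = (u1, r1)" "p2 = (u2, r2)" by fastforce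
  let ?q = "\<lambda>u y. s * (u \<bullet> y - \<psi> y) - \<sigma> / 2 * (norm u)\<^sup>2"
  have r: "\<And>y. ?q u1 y \<le> r1" "\<And>y. ?q u2 y \<le> r2"
    using p by (simp_all add: p_eq weakened_conj_le_iff)
  define u where "u = (1 - t) *\<^sub>R u1 + t *\<^sub>R u2"
  define d where "d = u1 - u2"
  define N where "N = t * (1 - t) * (norm d)\<^sup>2"
  have N: "N \<ge> 0" using t by (simp add: N_def)
  have u_norm: "(norm u)\<^sup>2 = (1 - t) * (norm u1)\<^sup>2 + t * (norm u2)\<^sup>2 - N"
    unfolding u_def N_def d_def by (rule norm_convex_combination)
  have "?q u y \<le> (1 - t) * r1 + t * r2" for y
  proof -
    define y1 where "y1 = y + (\<beta> * t) *\<^sub>R d"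
    define y2 where "y2 = y + (\<beta> * (t - 1)) *\<^sub>R d"
    have descent: "\<psi> (y + (\<beta> * r) *\<^sub>R d) \<le> \<psi> y + \<beta> * r * (gradient \<psi> y \<bullet> d) + \<beta> / 2 * r\<^sup>2 * (norm d)\<^sup>2"
      for r
      using descent_lemma[OF smooth, of y "(\<beta> * r) *\<^sub>R d"] \<beta> unfolding power2_norm_eq_inner
      by (simp add: power2_eq_square field_simps)
    note \<psi>1 = descent[of t, folded y1_def] and \<psi>2 = descent[of "t - 1", folded y2_def]
    have "(1 - t) * \<psi> y1 + t * \<psi> y2
        \<le> (1 - t) * (\<psi> y + \<beta> * t * (gradient \<psi> y \<bullet> d) + \<beta> / 2 * t\<^sup>2 * (norm d)\<^sup>2)
          + t * (\<psi> y + \<beta> * (t - 1) * (gradient \<psi> y \<bullet> d) + \<beta> / 2 * (t - 1)\<^sup>2 * (norm d)\<^sup>2)"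
      using \<psi>1 \<psi>2 t by (intro add_mono mult_left_mono) auto
    also have "\<dots> = \<psi> y + \<beta> / 2 * N"
      by (simp add: N_def power2_eq_square field_simps)
    finally have \<psi>: "s * ((1 - t) * \<psi> y1 + t * \<psi> y2) \<le> s * (\<psi> y + \<beta> / 2 * N)"
      using s by simp
    have "(1 - t) * (u1 \<bullet> y1) + t * (u2 \<bullet> y2) = u \<bullet> y + \<beta> * (t * (1 - t) * (d \<bullet> d))"
      unfolding y1_def y2_def u_def d_def
      by (simp add: inner_add_left inner_add_right inner_diff_left inner_diff_right inner_commute
          algebra_simps)
    then have inner: "(1 - t) * (u1 \<bullet> y1) + t * (u2 \<bullet> y2) = u \<bullet> y + \<beta> * N"
      by (simp add: N_def power2_norm_eq_inner)
    have "\<sigma> * N \<le> s * \<beta> * N" using \<sigma> N by (rule mult_right_mono)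
    have "?q u y = s * (u \<bullet> y + \<beta> * N) - s * (\<psi> y + \<beta> / 2 * N) - s * \<beta> / 2 * N
        - \<sigma> / 2 * ((1 - t) * (norm u1)\<^sup>2 + t * (norm u2)\<^sup>2) + \<sigma> / 2 * N"
      unfolding u_norm by (simp add: field_simps)
    also have "\<dots> \<le> s * (u \<bullet> y + \<beta> * N) - s * ((1 - t) * \<psi> y1 + t * \<psi> y2)
        - \<sigma> / 2 * ((1 - t) * (norm u1)\<^sup>2 + t * (norm u2)\<^sup>2)"
      using \<psi> \<open>\<sigma> * N \<le> s * \<beta> * N\<close> by (simp add: field_simps)
    also have "\<dots> = (1 - t) * ?q u1 y1 + t * ?q u2 y2"
      unfolding inner[symmetric] by (simp add: field_simps)
    also have "\<dots> \<le> (1 - t) * r1 + t * r2"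
      using r t by (intro add_mono mult_left_mono) auto
    finally show ?thesis .
  qed
  then show "(1 - t) *\<^sub>R p1 + t *\<^sub>R p2 \<in> {(x, r). weakened_conj s \<sigma> \<psi> x \<le> ereal r}"
    by (simp add: p_eq weakened_conj_le_iff u_def)
qed

lemma closed_add_weakened_conj_le:
  assumes "continuous_on UNIV h" "continuous_on UNIV L"
  shows "closed {x. ereal (h x) + weakened_conj s \<sigma> \<psi> (L x) \<le> ereal a}"
proof -
  have "{x. ereal (h x) + weakened_conj s \<sigma> \<psi> (L x) \<le> ereal a}
      = (\<Inter>y. {x. s * (L x \<bullet> y - \<psi> y) - \<sigma> / 2 * (norm (L x))\<^sup>2 \<le> a - h x})"
    by (auto simp: ereal_add_le_real_iff weakened_conj_le_iff)
  also have "closed \<dots>"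
    by (intro closed_INT ballI closed_Collect_le continuous_intros assms)
  finally show ?thesis .
qed

section \<open>The saddle point problem\<close>

text \<open>The model problem with the strong convexity of the smooth term already moved to the other term:
  minimise \<open>h + G \<circ> L\<close> with \<open>h\<close> convex and \<open>\<kappa>\<close>-smooth and \<open>G = s \<psi>\<^sup>* - \<sigma> / 2 \<parallel>\<cdot>\<parallel>\<^sup>2\<close>.\<close>

locale composite_problem =
  fixes L :: "'h::{real_inner,complete_space} \<Rightarrow> 'u::{real_inner,complete_space}"
    and h :: "'h \<Rightarrow> real" and \<psi> :: "'u \<Rightarrow> real" and \<beta> \<sigma> s \<kappa> :: real
  assumes L: "bounded_linear L"
    and h_convex: "convex_on UNIV h" and h_smooth: "lip_smooth \<kappa> h" and \<kappa>: "\<kappa> > 0"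
    and \<psi>_convex: "convex_on UNIV \<psi>" and \<psi>_smooth: "lip_smooth (1 / \<beta>) \<psi>"
    and \<beta>: "\<beta> > 0" and \<sigma>: "\<sigma> > 0" "\<sigma> \<le> s * \<beta>"
begin

abbreviation "L' \<equiv> adjoint L"
abbreviation "T \<equiv> gradient \<psi>"
abbreviation "G \<equiv> weakened_conj s \<sigma> \<psi>"

lemma s_pos: "s > 0"
  using \<beta> \<sigma> by (metis less_le_trans not_less zero_less_mult_pos2)

text \<open>Parametrisation of the graph of the subdifferential of \<open>G\<close>: the pairs \<open>(T y, graph_dual y)\<close>.\<close>

definition graph_dual :: "'u \<Rightarrow> 'u" where
  "graph_dual y = s *\<^sub>R y - \<sigma> *\<^sub>R T y"

lemma G_at_T: "G (T y) = ereal (s * (T y \<bullet> y - \<psi> y) - \<sigma> / 2 * (norm (T y))\<^sup>2)"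
proof (rule antisym)
  have "s * (T y \<bullet> y' - \<psi> y') \<le> s * (T y \<bullet> y - \<psi> y)" for y'
    using convex_gradient_inequality[OF \<psi>_convex \<psi>_smooth, of y y'] s_pos
    by (simp add: inner_diff_right)
  then show "G (T y) \<le> ereal (s * (T y \<bullet> y - \<psi> y) - \<sigma> / 2 * (norm (T y))\<^sup>2)"
    by (simp add: weakened_conj_le_iff)
qed (rule weakened_conj_ge)

text \<open>The point \<open>y + \<beta> (w - T y)\<close> in the supremum defining \<open>G w\<close> gives, by the descent lemma, a gain of
  \<open>s \<beta> / 2 \<parallel>w - T y\<parallel>\<^sup>2\<close> over the choice \<open>y\<close>; this pays for the concave term of \<open>G\<close>.\<close>

lemma G_subgradient: "G (T y) + ereal (graph_dual y \<bullet> (w - T y)) \<le> G w"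
proof -
  define v where "v = T y"
  have "\<psi> (y + \<beta> *\<^sub>R (w - v)) \<le> \<psi> y + T y \<bullet> (\<beta> *\<^sub>R (w - v)) + 1 / \<beta> / 2 * (norm (\<beta> *\<^sub>R (w - v)))\<^sup>2"
    by (rule descent_lemma[OF \<psi>_smooth])
  also have "\<dots> = \<psi> y + \<beta> * (v \<bullet> (w - v)) + \<beta> / 2 * ((w - v) \<bullet> (w - v))"
    using \<beta> by (simp add: v_def power_mult_distrib power2_eq_square flip: power2_norm_eq_inner)
  finally have "s * \<psi> (y + \<beta> *\<^sub>R (w - v)) \<le> s * (\<psi> y + \<beta> * (v \<bullet> (w - v)) + \<beta> / 2 * ((w - v) \<bullet> (w - v)))"
    using s_pos by simp
  moreover have "\<sigma> * ((w - v) \<bullet> (w - v)) \<le> s * \<beta> * ((w - v) \<bullet> (w - v))"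
    by (intro mult_right_mono \<sigma>) simp
  ultimately have "s * (v \<bullet> y - \<psi> y) - \<sigma> / 2 * (norm v)\<^sup>2 + graph_dual y \<bullet> (w - v)
      \<le> s * (w \<bullet> (y + \<beta> *\<^sub>R (w - v)) - \<psi> (y + \<beta> *\<^sub>R (w - v))) - \<sigma> / 2 * (norm w)\<^sup>2"
    unfolding graph_dual_def v_def[symmetric] power2_norm_eq_inner
    by (simp add: inner_add_left inner_add_right inner_diff_left inner_diff_right inner_commute
        algebra_simps)
  also have "ereal \<dots> \<le> G w" by (rule weakened_conj_ge)
  finally show ?thesis using G_at_T[of y] by (simp add: v_def)
qed

lemma T_monotone: "0 \<le> (T y - T y') \<bullet> (graph_dual y - graph_dual y')"
  using G_subgradient[of y "T y'"] G_subgradient[of y' "T y"]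
  by (simp add: G_at_T inner_diff_left inner_diff_right inner_commute)

lemma G_in_Gamma0: "G \<in> Gamma0"
proof -
  have "proper_fun G"
    unfolding proper_fun_def using weakened_conj_not_MInf G_at_T by (metis PInfty_neq_ereal(1))
  moreover have "lsc_fun G"
    unfolding lsc_fun_def
    using closed_add_weakened_conj_le[of "\<lambda>_. 0" "\<lambda>u. u" s \<sigma> \<psi>] by (simp add: zero_ereal_def[symmetric])
  ultimately show ?thesis
    using convex_weakened_conj[OF \<psi>_smooth \<beta> s_pos \<sigma>(2)] by (simp add: Gamma0_def)
qed

definition primal_fun :: "'h \<Rightarrow> ereal" where
  "primal_fun x = ereal (h x) + G (L x)"

definition dual_fun :: "'u \<Rightarrow> ereal" where
  "dual_fun u = fenchel_conj (\<lambda>x. ereal (h x)) (- L' u) + fenchel_conj G u"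

lemma primal_in_Gamma0:
  assumes "\<exists>x. primal_fun x \<noteq> \<infinity>"
  shows "primal_fun \<in> Gamma0"
proof -
  have "primal_fun x \<noteq> -\<infinity>" for x
    using weakened_conj_not_MInf[of s \<sigma> \<psi> "L x"] by (cases "G (L x)") (auto simp: primal_fun_def)
  then have "proper_fun primal_fun" using assms by (simp add: proper_fun_def)
  moreover have "lsc_fun primal_fun"
    unfolding lsc_fun_def primal_fun_def
    using closed_add_weakened_conj_le lip_smooth_continuous_on[OF h_smooth]
      linear_continuous_on[OF L] by blast
  moreover have "convex_fun primal_fun"
    unfolding convex_fun_def convex_alt
  proof (intro ballI allI impI, elim conjE)
    fix p1 p2 :: "'h \<times> real" and t :: real
    assume p: "p1 \<in> {(x, r). primal_fun x \<le> ereal r}" "p2 \<in> {(x, r). primal_fun x \<le> ereal r}"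
      and t: "0 \<le> t" "t \<le> 1"
    obtain x1 r1 x2 r2 where p_eq: "p1 = (x1, r1)" "p2 = (x2, r2)" by fastforce
    let ?x = "(1 - t) *\<^sub>R x1 + t *\<^sub>R x2"
    have "(L x1, r1 - h x1) \<in> {(u, r). G u \<le> ereal r}" "(L x2, r2 - h x2) \<in> {(u, r). G u \<le> ereal r}"
      using p by (simp_all add: p_eq primal_fun_def ereal_add_le_real_iff)
    then have "(1 - t) *\<^sub>R (L x1, r1 - h x1) + t *\<^sub>R (L x2, r2 - h x2) \<in> {(u, r). G u \<le> ereal r}"
      using convex_weakened_conj[OF \<psi>_smooth \<beta> s_pos \<sigma>(2)] t
      unfolding convex_fun_def by (intro convexD_alt)
    then have "G (L ?x) \<le> ereal ((1 - t) * (r1 - h x1) + t * (r2 - h x2))"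
      by (simp add: linear_simps[OF L])
    also have "\<dots> \<le> ereal ((1 - t) * r1 + t * r2 - h ?x)"
      using convex_onD[OF h_convex t, of x1 x2] by (simp add: algebra_simps)
    finally show "(1 - t) *\<^sub>R p1 + t *\<^sub>R p2 \<in> {(x, r). primal_fun x \<le> ereal r}"
      by (simp add: p_eq primal_fun_def ereal_add_le_real_iff)
  qed
  ultimately show ?thesis by (simp add: Gamma0_def)
qed

text \<open>The second equation is the inclusion of \<open>u\<close> in the subdifferential of \<open>G\<close> at \<open>L x\<close>, in the
  parametrisation above: it says that \<open>L x = T y\<close> and \<open>u = graph_dual y\<close> for \<open>y = (u + \<sigma> L x) / s\<close>.\<close>

definition saddle :: "('h \<times> 'u) set" where
  "saddle = {(x, u). gradient h x = - L' u \<and> L x = T (inverse s *\<^sub>R (u + \<sigma> *\<^sub>R L x))}"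

lemma saddleE:
  assumes "(x, u) \<in> saddle"
  obtains y where "gradient h x = - L' u" "L x = T y" "u = graph_dual y"
proof
  show "gradient h x = - L' u" "L x = T (inverse s *\<^sub>R (u + \<sigma> *\<^sub>R L x))"
    using assms by (auto simp: saddle_def)
  then show "u = graph_dual (inverse s *\<^sub>R (u + \<sigma> *\<^sub>R L x))"
    using s_pos by (simp add: graph_dual_def)
qed

lemma dual_fun_ge:
  assumes "G w = ereal d"
  shows "ereal (u \<bullet> (w - L x) - h x - d) \<le> dual_fun u"
proof -
  have "ereal (- L' u \<bullet> x) - ereal (h x) \<le> fenchel_conj (\<lambda>x. ereal (h x)) (- L' u)"
    unfolding fenchel_conj_def by (rule SUP_upper) simp
  moreover have "ereal (u \<bullet> w) - G w \<le> fenchel_conj G u"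
    unfolding fenchel_conj_def by (rule SUP_upper) simp
  ultimately have "(ereal (- L' u \<bullet> x) - ereal (h x)) + (ereal (u \<bullet> w) - G w) \<le> dual_fun u"
    unfolding dual_fun_def by (rule add_mono)
  then show ?thesis
    by (simp add: assms adjoint_hilbert'[OF L] inner_diff_right algebra_simps)
qed

lemma saddle_imp_minimizers:
  assumes "(x, u) \<in> saddle"
  shows "minimizer primal_fun x \<and> minimizer dual_fun u"
proof -
  obtain y where y: "gradient h x = - L' u" "L x = T y" "u = graph_dual y"
    using saddleE[OF assms] .
  obtain c where c: "G (L x) = ereal c" using G_at_T[of y] y(2) by metis
  have h_ge: "h x - L' u \<bullet> (x' - x) \<le> h x'" for x'
    using convex_gradient_inequality[OF h_convex h_smooth, of x x'] by (simp add: y(1))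
  have G_ge: "ereal (c + u \<bullet> (w - L x)) \<le> G w" for w
    using G_subgradient[of y w] c y by simp
  have "primal_fun x \<le> primal_fun x'" for x'
  proof -
    have "primal_fun x = ereal (h x + c)" by (simp add: primal_fun_def c)
    also have "\<dots> \<le> ereal (h x' + (c + u \<bullet> (L x' - L x)))"
      using h_ge[of x'] by (simp add: adjoint_hilbert'[OF L] linear_simps[OF L])
    also have "\<dots> \<le> primal_fun x'"
      using add_left_mono[OF G_ge[of "L x'"], of "ereal (h x')"] by (simp add: primal_fun_def)
    finally show ?thesis .
  qed
  moreover have "dual_fun u \<le> dual_fun u'" for u'
  proof -
    have "fenchel_conj (\<lambda>x. ereal (h x)) (- L' u) \<le> ereal (- L' u \<bullet> x - h x)"
      unfolding fenchel_conj_def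
      by (rule SUP_least) (use h_ge in \<open>simp add: inner_diff_right algebra_simps\<close>)
    moreover have "fenchel_conj G u \<le> ereal (u \<bullet> L x - c)"
      unfolding fenchel_conj_def
    proof (rule SUP_least)
      fix w
      show "ereal (u \<bullet> w) - G w \<le> ereal (u \<bullet> L x - c)"
        using G_ge[of w] by (cases "G w") (auto simp: inner_diff_right algebra_simps)
    qed
    ultimately have "dual_fun u \<le> ereal (- L' u \<bullet> x - h x) + ereal (u \<bullet> L x - c)"
      unfolding dual_fun_def by (rule add_mono)
    also have "\<dots> = ereal (u' \<bullet> (L x - L x) - h x - c)" by (simp add: adjoint_hilbert'[OF L])
    also have "\<dots> \<le> dual_fun u'" using dual_fun_ge[OF c] .
    finally show ?thesis .
  qed
  ultimately show ?thesis by (auto simp: minimizer_def is_arg_min_def not_less)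
qed

text \<open>A vanishing duality gap turns both Fenchel--Young inequalities into equalities. For the term
  \<open>G\<close> the resulting subgradient inequality at \<open>L x\<close>, added to the one at \<open>T y\<close>, forces
  \<open>L x = T y\<close>.\<close>

lemma no_duality_gap_imp_saddle:
  assumes gap: "primal_fun x = - dual_fun u"
  shows "(x, u) \<in> saddle"
proof -
  obtain d0 where "G (T 0) = ereal d0" using G_at_T by blast
  then have "dual_fun u \<noteq> -\<infinity>" using dual_fun_ge[of "T 0" d0 u 0] by auto
  then have "G (L x) \<noteq> \<infinity>" using gap by (cases "dual_fun u") (auto simp: primal_fun_def)
  then obtain c where c: "G (L x) = ereal c"
    using weakened_conj_not_MInf by (cases "G (L x)") auto
  then have dual_eq: "dual_fun u = ereal (- (h x + c))"
    using gap by (cases "dual_fun u") (auto simp: primal_fun_def)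
  have h_ge: "h x + (- L' u) \<bullet> (x' - x) \<le> h x'" for x'
    using dual_fun_ge[OF c, of u x'] unfolding dual_eq
    by (simp add: adjoint_hilbert'[OF L] linear_simps[OF L] inner_diff_right)
  define y where "y = inverse s *\<^sub>R (u + \<sigma> *\<^sub>R L x)"
  define v where "v = T y"
  obtain d where d: "G v = ereal d" using G_at_T v_def by blast
  have "c + u \<bullet> (v - L x) \<le> d"
    using dual_fun_ge[OF d, of u x] unfolding dual_eq by simp
  moreover have "d + graph_dual y \<bullet> (L x - v) \<le> c"
    using G_subgradient[of y "L x"] c d by (simp add: v_def)
  moreover have "graph_dual y = u + \<sigma> *\<^sub>R (L x - v)"
    using s_pos by (simp add: graph_dual_def y_def v_def algebra_simps)
  ultimately have "\<sigma> * ((L x - v) \<bullet> (L x - v)) \<le> 0"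
    by (simp add: inner_add_left inner_diff_left inner_diff_right algebra_simps)
  then have "(L x - v) \<bullet> (L x - v) \<le> 0" using \<sigma>(1) by (simp add: mult_le_0_iff)
  then have "L x = v" by (metis eq_iff_diff_eq_0 inner_ge_zero inner_eq_zero_iff order_antisym)
  moreover have "gradient h x = - L' u"
    by (rule gradient_eq_of_minimum[OF h_smooth \<kappa> h_ge])
  ultimately show ?thesis by (simp add: saddle_def v_def y_def)
qed

end

section \<open>The iteration\<close>

lemma tendsto_zero_inner_bounded:
  fixes a w :: "'i \<Rightarrow> 'a::real_inner"
  assumes "(a \<longlongrightarrow> 0) F" "\<And>k. norm (w k) \<le> M"
  shows "((\<lambda>k. a k \<bullet> w k) \<longlongrightarrow> 0) F"
proof (rule Lim_null_comparison)
  have "norm (a k \<bullet> w k) \<le> norm (a k) * M" for k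
    using Cauchy_Schwarz_ineq2[of "a k" "w k"] mult_left_mono[OF assms(2)[of k], of "norm (a k)"]
    by simp
  then show "eventually (\<lambda>k. norm (a k \<bullet> w k) \<le> norm (a k) * M) F" by simp
  show "((\<lambda>k. norm (a k) * M) \<longlongrightarrow> 0) F"
    using tendsto_mult_left_zero[OF tendsto_norm_zero[OF assms(1)]] .
qed

text \<open>The constant is the determinant of the form divided by its trace; it lies below the smaller
  eigenvalue, so subtracting it from both diagonal coefficients leaves a positive semidefinite
  form.\<close>

lemma quadratic_form_coercive:
  fixes A B n X Y :: real
  assumes "A > 0" "B > 0" and det: "n\<^sup>2 < A * B"
  defines "c \<equiv> (A * B - n\<^sup>2) / (A + B)"
  shows "c > 0" "c * (X\<^sup>2 + Y\<^sup>2) \<le> A * X\<^sup>2 - 2 * n * X * Y + B * Y\<^sup>2"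
proof -
  show "c > 0" using assms by simp
  have c: "c * (A + B) = A * B - n\<^sup>2" using assms by (simp add: c_def)
  have "(A - c) * (B - c) = n\<^sup>2 + c\<^sup>2" using c by (simp add: algebra_simps power2_eq_square)
  then have prod: "n\<^sup>2 \<le> (A - c) * (B - c)" by simp
  have "A * (A + B) > A * B - n\<^sup>2" using assms(1) zero_le_power2[of n] by (simp add: algebra_simps add_pos_nonneg)
  then have "c * (A + B) < A * (A + B)" using c by simp
  then have pos: "A - c > 0" using mult_right_less_imp_less[of c "A + B" A] assms(1,2) by simp
  have "(A - c) * ((A - c) * X\<^sup>2 - 2 * n * X * Y + (B - c) * Y\<^sup>2)
      = ((A - c) * X - n * Y)\<^sup>2 + ((A - c) * (B - c) - n\<^sup>2) * Y\<^sup>2"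
    by (simp add: algebra_simps power2_eq_square)
  also have "\<dots> \<ge> 0" using prod by simp
  finally have "0 \<le> (A - c) * X\<^sup>2 - 2 * n * X * Y + (B - c) * Y\<^sup>2"
    using pos by (simp add: zero_le_mult_iff)
  then show "c * (X\<^sup>2 + Y\<^sup>2) \<le> A * X\<^sup>2 - 2 * n * X * Y + B * Y\<^sup>2" by (simp add: algebra_simps)
qed

locale primal_dual_iteration = composite_problem +
  fixes \<tau> :: real and x :: "nat \<Rightarrow> 'a" and u :: "nat \<Rightarrow> 'b"
  assumes \<tau>: "\<tau> > 0" "\<tau> * (\<sigma> * (onorm L)\<^sup>2 + \<kappa> / 2) < 1"
    and u_step: "\<And>k. u (Suc k) = u k + \<sigma> *\<^sub>R L (x k) - \<sigma> *\<^sub>R T (inverse s *\<^sub>R (u k + \<sigma> *\<^sub>R L (x k)))"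
    and x_step: "\<And>k. x (Suc k) = x k - \<tau> *\<^sub>R (gradient h (x k) + L' (2 *\<^sub>R u (Suc k) - u k))"
begin

lemmas L_simps = linear_simps[OF L] linear_simps[OF bounded_linear_adjoint[OF L]]

definition z :: "nat \<Rightarrow> 'a \<times> 'b" where "z k = (x k, u k)"

definition y :: "nat \<Rightarrow> 'b" where "y k = inverse s *\<^sub>R (u k + \<sigma> *\<^sub>R L (x k))"

lemma graph_dual_y: "graph_dual (y k) = u (Suc k)"
  using s_pos by (simp add: graph_dual_def y_def u_step)

definition metric :: "'a \<times> 'b \<Rightarrow> 'a \<times> 'b" where
  "metric p = (inverse \<tau> *\<^sub>R fst p + L' (snd p), L (fst p) + inverse \<sigma> *\<^sub>R snd p)"

text \<open>In this metric the iteration is a forward-backward step: \<open>metric (z k - z (Suc k))\<close> is the gradient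
  at \<open>z k\<close> plus an element of the monotone operator of the saddle problem at \<open>z (Suc k)\<close>.\<close>

lemma residual_fst: "fst (metric (z k - z (Suc k))) = gradient h (x k) + L' (u (Suc k))"
proof -
  have "x k - x (Suc k) = \<tau> *\<^sub>R (gradient h (x k) + L' (2 *\<^sub>R u (Suc k) - u k))"
    by (simp add: x_step)
  then show ?thesis
    using \<tau>(1) by (simp add: metric_def z_def L_simps scaleR_2)
qed

lemma residual_snd: "inverse \<sigma> *\<^sub>R (u k - u (Suc k)) = T (y k) - L (x k)"
  using \<sigma>(1) by (simp add: u_step y_def algebra_simps)

lemma linear_metric: "linear metric"
  by (rule linearI) (simp_all add: metric_def L_simps algebra_simps)

lemma metric_symmetric: "p \<bullet> metric q = metric p \<bullet> q"
  by (simp add: metric_def inner_prod_def inner_add_left inner_add_right inner_commute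
      adjoint_hilbert[OF L, symmetric] adjoint_hilbert'[OF L])

text \<open>The determinant over the trace of the form \<open>(1 / \<tau> - \<kappa> / 2) X\<^sup>2 - 2 \<parallel>L\<parallel> X Y + Y\<^sup>2 / \<sigma>\<close>.\<close>

definition modulus :: real where
  "modulus = ((inverse \<tau> - \<kappa> / 2) * inverse \<sigma> - (onorm L)\<^sup>2) / (inverse \<tau> - \<kappa> / 2 + inverse \<sigma>)"

text \<open>The step size condition is the positivity of the metric after the loss \<open>\<kappa> / 2\<close> that the explicit
  gradient step causes.\<close>

lemma metric_coercive:
  "modulus > 0" "modulus * (norm p)\<^sup>2 + \<kappa> / 2 * (norm (fst p))\<^sup>2 \<le> p \<bullet> metric p"
proof -
  define A where "A = inverse \<tau> - \<kappa> / 2"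
  have "\<sigma> * (onorm L)\<^sup>2 + \<kappa> / 2 < inverse \<tau>"
    using \<tau> by (simp add: field_simps)
  then have A: "\<sigma> * (onorm L)\<^sup>2 < A" by (simp add: A_def)
  moreover have "0 \<le> \<sigma> * (onorm L)\<^sup>2" using \<sigma>(1) by simp
  ultimately have A_pos: "A > 0" by linarith
  have det: "(onorm L)\<^sup>2 < A * inverse \<sigma>" using A \<sigma>(1) by (simp add: field_simps)
  note coercive = quadratic_form_coercive[OF A_pos _ det]
  show "modulus > 0" using coercive(1) \<sigma>(1) by (simp add: modulus_def A_def)
  have "modulus * ((norm (fst p))\<^sup>2 + (norm (snd p))\<^sup>2)
      \<le> A * (norm (fst p))\<^sup>2 - 2 * onorm L * norm (fst p) * norm (snd p) + inverse \<sigma> * (norm (snd p))\<^sup>2"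
    using coercive(2) \<sigma>(1) by (simp add: modulus_def A_def)
  also have "\<dots> \<le> A * (norm (fst p))\<^sup>2 + 2 * (L (fst p) \<bullet> snd p) + inverse \<sigma> * (norm (snd p))\<^sup>2"
  proof -
    have "\<bar>L (fst p) \<bullet> snd p\<bar> \<le> norm (L (fst p)) * norm (snd p)" by (rule Cauchy_Schwarz_ineq2)
    also have "\<dots> \<le> onorm L * norm (fst p) * norm (snd p)"
      by (intro mult_right_mono onorm[OF L]) simp
    finally show ?thesis by simp
  qed
  also have "\<dots> = p \<bullet> metric p - \<kappa> / 2 * (norm (fst p))\<^sup>2"
    unfolding metric_def A_def power2_norm_eq_inner inner_prod_def
    by (simp add: inner_add_right adjoint_hilbert[OF L, symmetric] inner_commute algebra_simps)
  finally show "modulus * (norm p)\<^sup>2 + \<kappa> / 2 * (norm (fst p))\<^sup>2 \<le> p \<bullet> metric p"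
    by (simp add: norm_prod_def)
qed

lemma metric_ge: "modulus * (norm p)\<^sup>2 \<le> p \<bullet> metric p"
  using metric_coercive(2)[of p] \<kappa> by (smt (verit) mult_nonneg_nonneg zero_le_power2 half_gt_zero)

text \<open>Fejer monotonicity. Monotonicity of the saddle operator disposes of everything except the
  gradient of \<open>h\<close> being evaluated one step late; cocoercivity bounds that error by
  \<open>\<kappa> / 4 \<parallel>x k - x (Suc k)\<parallel>\<^sup>2\<close>.\<close>

lemma fejer_step:
  assumes "p \<in> saddle"
  shows "(z (Suc k) - p) \<bullet> metric (z (Suc k) - p) + modulus * (norm (z k - z (Suc k)))\<^sup>2
    \<le> (z k - p) \<bullet> metric (z k - p)"
proof -
  obtain xs us where p: "p = (xs, us)" by fastforce
  obtain ys where ys: "gradient h xs = - L' us" "L xs = T ys" "us = graph_dual ys"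
    using saddleE assms unfolding p by blast
  define d where "d = z k - z (Suc k)"
  define e where "e = z (Suc k) - p"
  define D where "D = gradient h (x k) - gradient h xs"
  define dx where "dx = x k - x (Suc k)"
  have "fst (metric d) = D + L' (snd e)"
    using residual_fst[of k] by (simp add: d_def e_def D_def ys(1) L_simps z_def p)
  moreover have "snd (metric d) = (T (y k) - T ys) - L (fst e)"
    using residual_snd[of k] by (simp add: metric_def d_def e_def z_def p L_simps ys(2)[symmetric])
  ultimately have "e \<bullet> metric d = fst e \<bullet> D + (T (y k) - T ys) \<bullet> (graph_dual (y k) - graph_dual ys)"
    by (simp add: inner_prod_def inner_add_right inner_diff_right adjoint_hilbert[OF L, symmetric]
        e_def z_def p graph_dual_y ys(3) inner_commute)
  then have "e \<bullet> metric d \<ge> fst e \<bullet> D" using T_monotone[of "y k" ys] by simp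
  moreover have "fst e \<bullet> D \<ge> - (\<kappa> / 4 * (norm dx)\<^sup>2)"
  proof -
    have "fst e \<bullet> D = D \<bullet> (x k - xs) - D \<bullet> dx"
      by (simp add: e_def z_def p dx_def inner_commute inner_diff_right)
    moreover have "(norm D)\<^sup>2 / \<kappa> \<le> D \<bullet> (x k - xs)"
      unfolding D_def by (rule gradient_cocoercive[OF h_convex h_smooth \<kappa>])
    moreover have "(norm D)\<^sup>2 / \<kappa> - D \<bullet> dx + \<kappa> / 4 * (norm dx)\<^sup>2 = (norm (D - (\<kappa> / 2) *\<^sub>R dx))\<^sup>2 / \<kappa>"
      using \<kappa> unfolding power2_norm_eq_inner
      by (simp add: inner_diff_left inner_diff_right inner_commute field_simps)
    moreover have "\<dots> \<ge> 0" using \<kappa> by simp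
    ultimately show ?thesis by linarith
  qed
  moreover have "modulus * (norm d)\<^sup>2 + \<kappa> / 2 * (norm dx)\<^sup>2 \<le> d \<bullet> metric d"
    using metric_coercive(2)[of d] by (simp add: d_def dx_def z_def)
  moreover have "(e + d) \<bullet> metric (e + d) = e \<bullet> metric e + 2 * (e \<bullet> metric d) + d \<bullet> metric d"
    using metric_symmetric[of e d]
    by (simp add: linear_add[OF linear_metric] inner_add_left inner_add_right inner_commute)
  moreover have "e + d = z k - p" by (simp add: e_def d_def)
  ultimately show ?thesis unfolding e_def[symmetric] d_def[symmetric] by simp
qed

lemma fejer_consequences:
  assumes "p \<in> saddle"
  shows "convergent (\<lambda>k. (z k - p) \<bullet> metric (z k - p))" (is "convergent ?E")
    and "\<exists>M. \<forall>k. norm (z k) \<le> M"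
    and "(\<lambda>k. z k - z (Suc k)) \<longlonglongrightarrow> 0"
proof -
  have modulus_nonneg: "0 \<le> modulus * r\<^sup>2" for r using metric_coercive(1) by simp
  have nonneg: "0 \<le> ?E k" for k
    using order_trans[OF modulus_nonneg metric_ge] .
  have dec: "decseq ?E"
    unfolding decseq_Suc_iff using fejer_step[OF assms] modulus_nonneg by (smt (verit))
  obtain a where a: "?E \<longlonglongrightarrow> a" using decseq_convergent[OF dec, of 0] nonneg by blast
  then show "convergent ?E" by (auto simp: convergent_def)
  have "norm (z k) \<le> norm p + sqrt (?E 0 / modulus)" for k
  proof -
    have "modulus * (norm (z k - p))\<^sup>2 \<le> ?E 0"
      using metric_ge[of "z k - p"] decseqD[OF dec, of 0 k] by simp
    then have "norm (z k - p) \<le> sqrt (?E 0 / modulus)"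
      using metric_coercive(1) by (intro real_le_rsqrt) (simp add: field_simps)
    then show ?thesis using norm_triangle_sub[of "z k" p] by simp
  qed
  then show "\<exists>M. \<forall>k. norm (z k) \<le> M" by blast
  have "(\<lambda>k. (?E k - ?E (Suc k)) / modulus) \<longlonglongrightarrow> (a - a) / modulus"
    using metric_coercive(1) by (intro tendsto_intros a LIMSEQ_Suc[OF a]) simp
  then have lim: "(\<lambda>k. (?E k - ?E (Suc k)) / modulus) \<longlonglongrightarrow> 0" by simp
  have "(norm (z k - z (Suc k)))\<^sup>2 \<le> (?E k - ?E (Suc k)) / modulus" for k
    using fejer_step[OF assms, of k] metric_coercive(1) by (simp add: field_simps)
  then have "(\<lambda>k. (norm (z k - z (Suc k)))\<^sup>2) \<longlonglongrightarrow> 0"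
    by (intro tendsto_sandwich[OF _ _ tendsto_const lim]) auto
  then have "(\<lambda>k. sqrt ((norm (z k - z (Suc k)))\<^sup>2)) \<longlonglongrightarrow> sqrt 0" by (rule tendsto_real_sqrt)
  then show "(\<lambda>k. z k - z (Suc k)) \<longlonglongrightarrow> 0" by (simp add: tendsto_norm_zero_iff)
qed

text \<open>Demiclosedness. The iterates are tested against an arbitrary point of the graph of the monotone
  operator. The products of two weakly convergent sequences, \<open>u (Suc k) \<bullet> L (x k)\<close>, cancel because the coupling
  is skew, so the monotonicity inequality survives in the weak limit; maximality then gives the
  saddle equations. For the dual part it suffices to test with the single point
  \<open>(lu + \<sigma> L lx) / s\<close>.\<close>

lemma weak_cluster_point_in_saddle:
  assumes F: "F \<noteq> bot" "F \<le> sequentially"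
    and bounded: "\<And>k. norm (z k) \<le> M"
    and asymptotic: "(\<lambda>k. z k - z (Suc k)) \<longlonglongrightarrow> 0"
    and l: "\<And>w. ((\<lambda>k. z k \<bullet> w) \<longlongrightarrow> l \<bullet> w) F"
  shows "l \<in> saddle"
proof -
  obtain lx lu where l_eq: "l = (lx, lu)" by fastforce
  have x_lim: "((\<lambda>k. x k \<bullet> w) \<longlongrightarrow> lx \<bullet> w) F" for w using l[of "(w, 0)"] by (simp add: z_def l_eq)
  have u_lim0: "((\<lambda>k. u k \<bullet> w) \<longlongrightarrow> lu \<bullet> w) F" for w using l[of "(0, w)"] by (simp add: z_def l_eq)
  have x_bounded: "norm (x k) \<le> M" and u_bounded: "norm (u k) \<le> M" for k
    using bounded[of k] norm_fst_le[of "x k" "u k"] norm_snd_le[of "u k" "x k"] by (auto simp: z_def)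
  have "((\<lambda>k. z k - z (Suc k)) \<longlongrightarrow> 0) F" using tendsto_mono[OF F(2) asymptotic] .
  then have dx: "((\<lambda>k. x k - x (Suc k)) \<longlongrightarrow> 0) F" and du: "((\<lambda>k. u k - u (Suc k)) \<longlongrightarrow> 0) F"
    using tendsto_fst[of "\<lambda>k. z k - z (Suc k)" 0 F] tendsto_snd[of "\<lambda>k. z k - z (Suc k)" 0 F]
    by (simp_all add: z_def)
  have u_lim: "((\<lambda>k. u (Suc k) \<bullet> w) \<longlongrightarrow> lu \<bullet> w) F" for w
    using tendsto_diff[OF u_lim0[of w] tendsto_inner[OF du tendsto_const[of w]]]
    by (simp add: inner_diff_left)
  define a where "a k = inverse \<tau> *\<^sub>R (x k - x (Suc k)) + L' (u k - u (Suc k))" for k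
  define b where "b k = inverse \<sigma> *\<^sub>R (u k - u (Suc k))" for k
  have a_eq: "gradient h (x k) = a k - L' (u (Suc k))" for k
    using residual_fst[of k] by (simp add: a_def metric_def z_def)
  have b_eq: "T (y k) = L (x k) + b k" for k
    using residual_snd[of k] by (simp add: b_def)
  have a_lim: "(a \<longlongrightarrow> 0) F"
    unfolding a_def
    using tendsto_add[OF tendsto_scaleR[OF tendsto_const[of "inverse \<tau>"] dx]
        bounded_linear.tendsto_zero[OF bounded_linear_adjoint[OF L] du]] by simp
  have b_lim: "(b \<longlongrightarrow> 0) F"
    unfolding b_def using tendsto_scaleR[OF tendsto_const[of "inverse \<sigma>"] du] by simp
  have limit_inequality:
    "0 \<le> (- L' lu - gradient h p) \<bullet> (lx - p) + (L lx - T w) \<bullet> (lu - graph_dual w)" for p w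
  proof -
    define R where "R k = u (Suc k) \<bullet> (L p - T w) + a k \<bullet> (x k - p)
      - x k \<bullet> (gradient h p + L' (graph_dual w)) + gradient h p \<bullet> p
      + b k \<bullet> (u (Suc k) - graph_dual w) + T w \<bullet> graph_dual w" for k
    have "0 \<le> R k" for k
    proof -
      have "0 \<le> (norm (gradient h (x k) - gradient h p))\<^sup>2 / \<kappa>" using \<kappa> by simp
      also have "\<dots> \<le> (gradient h (x k) - gradient h p) \<bullet> (x k - p)"
        by (rule gradient_cocoercive[OF h_convex h_smooth \<kappa>])
      finally have "0 \<le> (gradient h (x k) - gradient h p) \<bullet> (x k - p)
          + (T (y k) - T w) \<bullet> (u (Suc k) - graph_dual w)"
        using T_monotone[of "y k" w] by (simp add: graph_dual_y)
      also have "\<dots> = R k"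
        unfolding R_def a_eq b_eq
        by (simp add: inner_add_left inner_add_right inner_diff_left inner_diff_right L_simps
            adjoint_hilbert'[OF L] adjoint_hilbert[OF L, symmetric] inner_commute)
      finally show ?thesis .
    qed
    moreover have "(R \<longlongrightarrow> lu \<bullet> (L p - T w) + 0 - lx \<bullet> (gradient h p + L' (graph_dual w))
        + gradient h p \<bullet> p + 0 + T w \<bullet> graph_dual w) F"
      unfolding R_def
    proof (intro tendsto_add tendsto_diff u_lim x_lim tendsto_const)
      show "((\<lambda>k. a k \<bullet> (x k - p)) \<longlongrightarrow> 0) F"
        by (rule tendsto_zero_inner_bounded[OF a_lim norm_triangle_le_diff[OF add_right_mono[OF x_bounded]]])
      show "((\<lambda>k. b k \<bullet> (u (Suc k) - graph_dual w)) \<longlongrightarrow> 0) F"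
        by (rule tendsto_zero_inner_bounded[OF b_lim norm_triangle_le_diff[OF add_right_mono[OF u_bounded]]])
    qed
    ultimately have "0 \<le> lu \<bullet> (L p - T w) + 0 - lx \<bullet> (gradient h p + L' (graph_dual w))
        + gradient h p \<bullet> p + 0 + T w \<bullet> graph_dual w"
      using F(1) by (intro tendsto_lowerbound) auto
    then show ?thesis
      by (simp add: inner_add_left inner_add_right inner_diff_left inner_diff_right L_simps
          adjoint_hilbert'[OF L] adjoint_hilbert[OF L, symmetric] inner_commute)
  qed
  define w where "w = inverse s *\<^sub>R (lu + \<sigma> *\<^sub>R L lx)"
  have "lu - graph_dual w = - \<sigma> *\<^sub>R (L lx - T w)"
    using s_pos by (simp add: graph_dual_def w_def algebra_simps)
  then have "\<sigma> * ((L lx - T w) \<bullet> (L lx - T w)) \<le> 0"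
    using limit_inequality[of lx w] by simp
  then have "(L lx - T w) \<bullet> (L lx - T w) \<le> 0" using \<sigma>(1) by (simp add: mult_le_0_iff)
  then have w: "L lx = T w" by (metis eq_iff_diff_eq_0 inner_ge_zero inner_eq_zero_iff order_antisym)
  have "gradient h lx = - L' lu"
    using limit_inequality[of _ w] w by (intro gradient_eq_of_monotone[OF h_smooth \<kappa>]) simp
  with w show ?thesis by (simp add: saddle_def l_eq w_def)
qed

theorem converges_weakly_to_saddle:
  assumes "saddle \<noteq> {}"
  shows "\<exists>xh uh. (xh, uh) \<in> saddle \<and> weakly_converges x xh \<and> weakly_converges u uh"
proof -
  obtain p where p: "p \<in> saddle" using assms by blast
  obtain M where M: "\<And>k. norm (z k) \<le> M" using fejer_consequences(2)[OF p] by blast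
  have "\<exists>l\<in>saddle. weakly_converges z l"
  proof (rule opial[OF linear_metric metric_symmetric metric_coercive(1) metric_ge M])
    fix q assume "q \<in> saddle"
    then show "convergent (\<lambda>k. (z k - q) \<bullet> metric (z k - q))" by (rule fejer_consequences(1))
  next
    fix F l assume "F \<noteq> bot" "F \<le> sequentially" "\<And>w. ((\<lambda>k. z k \<bullet> w) \<longlongrightarrow> l \<bullet> w) F"
    then show "l \<in> saddle"
      by (rule weak_cluster_point_in_saddle[OF _ _ M fejer_consequences(3)[OF p]])
  qed
  then obtain l where l: "l \<in> saddle" "weakly_converges z l" by blast
  obtain xh uh where l_eq: "l = (xh, uh)" by fastforce
  have "(\<lambda>k. z k \<bullet> (w, v)) \<longlonglongrightarrow> l \<bullet> (w, v)" for w v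
    using l(2) by (auto simp: weakly_converges_def)
  from this[of _ 0] this[of 0] have "weakly_converges x xh" "weakly_converges u uh"
    by (simp_all add: weakly_converges_def z_def l_eq)
  then show ?thesis using l(1) l_eq by blast
qed

end

section \<open>Shifting strong convexity to the other term\<close>

lemma GDERIV_norm_square_linear:
  fixes L :: "'a::{real_inner,complete_space} \<Rightarrow> 'b::{real_inner,complete_space}"
  assumes "bounded_linear L"
  shows "GDERIV (\<lambda>x. r / 2 * (norm (L x))\<^sup>2) x :> r *\<^sub>R adjoint L (L x)"
proof -
  have "((\<lambda>x. r / 2 * (L x \<bullet> L x)) has_derivative (\<lambda>h. r / 2 * (L x \<bullet> L h + L h \<bullet> L x))) (at x)"
    by (intro has_derivative_mult_right has_derivative_inner bounded_linear_imp_has_derivative assms)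
  moreover have "(\<lambda>h. r / 2 * (L x \<bullet> L h + L h \<bullet> L x)) = (\<lambda>h. h \<bullet> (r *\<^sub>R adjoint L (L x)))"
    by (simp add: fun_eq_iff adjoint_hilbert[OF assms, symmetric] inner_commute)
  ultimately show ?thesis unfolding gderiv_def power2_norm_eq_inner by metis
qed

text \<open>The quadratic form \<open>\<rho> / 2 \<parallel>x\<parallel>\<^sup>2 - \<rho> / (2 \<parallel>L\<parallel>\<^sup>2) \<parallel>L x\<parallel>\<^sup>2\<close> is nonnegative, hence convex, and is added to the
  convex function \<open>f - \<rho> / 2 \<parallel>\<cdot>\<parallel>\<^sup>2\<close>.\<close>

lemma convex_on_minus_norm_square_linear:
  fixes L :: "'a::real_inner \<Rightarrow> 'b::real_inner"
  assumes L: "bounded_linear L" "onorm L > 0" and "\<rho> > 0" "strongly_convex \<rho> f"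
  shows "convex_on UNIV (\<lambda>x. f x - \<rho> / (onorm L)\<^sup>2 / 2 * (norm (L x))\<^sup>2)"
proof -
  define r where "r = \<rho> / (onorm L)\<^sup>2"
  have "convex_on UNIV (\<lambda>x. f x - r / 2 * (norm (L x))\<^sup>2)"
  proof (rule convex_onI)
    fix t :: real and x y :: 'a assume t: "0 < t" "t < 1"
    let ?w = "(1 - t) *\<^sub>R x + t *\<^sub>R y"
    have "f ?w - \<rho> / 2 * (norm ?w)\<^sup>2
        \<le> (1 - t) * (f x - \<rho> / 2 * (norm x)\<^sup>2) + t * (f y - \<rho> / 2 * (norm y)\<^sup>2)"
      using assms(4) t convex_onD[of UNIV "\<lambda>x. f x - \<rho> / 2 * (norm x)\<^sup>2" t x y]
      by (simp add: strongly_convex_def)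
    then have f: "f ?w \<le> (1 - t) * f x + t * f y - \<rho> / 2 * (t * (1 - t) * (norm (x - y))\<^sup>2)"
      unfolding norm_convex_combination by (simp add: field_simps)
    have "(norm (L (x - y)))\<^sup>2 \<le> (onorm L * norm (x - y))\<^sup>2"
      by (intro power_mono onorm L) simp
    then have "r * (norm (L (x - y)))\<^sup>2 \<le> \<rho> * (norm (x - y))\<^sup>2"
      using L(2) assms(3) by (simp add: r_def power_mult_distrib field_simps)
    then have "t * (1 - t) * (r * (norm (L (x - y)))\<^sup>2) \<le> t * (1 - t) * (\<rho> * (norm (x - y))\<^sup>2)"
      using t by (intro mult_left_mono) auto
    moreover have norm_L: "(norm (L ?w))\<^sup>2
        = (1 - t) * (norm (L x))\<^sup>2 + t * (norm (L y))\<^sup>2 - t * (1 - t) * (norm (L (x - y)))\<^sup>2"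
      unfolding linear_simps[OF L(1)] by (rule norm_convex_combination)
    have "r / 2 * (norm (L ?w))\<^sup>2 = (1 - t) * (r / 2 * (norm (L x))\<^sup>2) + t * (r / 2 * (norm (L y))\<^sup>2)
        - t * (1 - t) * (r * (norm (L (x - y)))\<^sup>2) / 2"
      unfolding norm_L by (simp add: field_simps)
    ultimately show "f ?w - r / 2 * (norm (L ?w))\<^sup>2
        \<le> (1 - t) * (f x - r / 2 * (norm (L x))\<^sup>2) + t * (f y - r / 2 * (norm (L y))\<^sup>2)"
      using f by (simp add: field_simps)
  qed simp
  then show ?thesis by (simp add: r_def)
qed

lemma lip_smooth_minus_norm_square_linear:
  fixes L :: "'a::{real_inner,complete_space} \<Rightarrow> 'b::{real_inner,complete_space}"
  assumes L: "bounded_linear L" and smooth: "lip_smooth k f" and r: "r \<ge> 0"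
  shows "gradient (\<lambda>x. f x - r / 2 * (norm (L x))\<^sup>2) x = gradient f x - r *\<^sub>R adjoint L (L x)"
    and "lip_smooth (k + r * (onorm L)\<^sup>2) (\<lambda>x. f x - r / 2 * (norm (L x))\<^sup>2)"
proof -
  let ?h = "\<lambda>x. f x - r / 2 * (norm (L x))\<^sup>2"
  have deriv: "GDERIV ?h x :> gradient f x - r *\<^sub>R adjoint L (L x)" for x
    by (intro GDERIV_diff lip_smooth_GDERIV[OF smooth] GDERIV_norm_square_linear[OF L])
  then show gradient: "gradient ?h x = gradient f x - r *\<^sub>R adjoint L (L x)" for x
    by (rule gradient_eqI)
  show "lip_smooth (k + r * (onorm L)\<^sup>2) ?h"
    unfolding lip_smooth_def
  proof (intro conjI allI lipschitz_onI)
    show "?h differentiable at x" for x using deriv[of x] by (auto simp: gderiv_def differentiable_def)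
    have "k \<ge> 0" using smooth by (auto simp: lip_smooth_def lipschitz_on_def)
    then show "0 \<le> k + r * (onorm L)\<^sup>2" using r by simp
    fix x y :: 'a
    have "norm (adjoint L (L (x - y))) \<le> onorm L * norm (L (x - y))"
      by (rule norm_adjoint_le[OF L])
    also have "\<dots> \<le> onorm L * (onorm L * norm (x - y))"
      by (intro mult_left_mono onorm onorm_pos_le L)
    finally have "r * norm (adjoint L (L (x - y))) \<le> r * (onorm L * (onorm L * norm (x - y)))"
      using r by (rule mult_left_mono)
    then have "norm (r *\<^sub>R adjoint L (L (x - y))) \<le> r * (onorm L)\<^sup>2 * norm (x - y)"
      using r by (simp add: power2_eq_square algebra_simps)
    moreover have "gradient ?h x - gradient ?h y = (gradient f x - gradient f y) - r *\<^sub>R adjoint L (L (x - y))"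
      unfolding gradient
      by (simp add: linear_simps[OF L] linear_simps[OF bounded_linear_adjoint[OF L]] algebra_simps)
    ultimately have "norm (gradient ?h x - gradient ?h y) \<le> k * norm (x - y) + r * (onorm L)\<^sup>2 * norm (x - y)"
      using lip_smooth_norm_le[OF smooth, of x y]
      by (metis add_mono norm_triangle_le_diff)
    then show "dist (gradient ?h x) (gradient ?h y) \<le> (k + r * (onorm L)\<^sup>2) * dist x y"
      by (simp add: dist_norm algebra_simps)
  qed
qed

theorem theorem3:
  fixes L :: "'h::{real_inner,complete_space} \<Rightarrow> 'u::{real_inner,complete_space}"
    and f fhat :: "'h \<Rightarrow> real"
    and \<psi> :: "'u \<Rightarrow> real"
    and T :: "'u \<Rightarrow> 'u"
    and g gcheck :: "'u \<Rightarrow> ereal"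
    and \<rho> \<beta> \<sigma> \<tau> :: real
    and primal :: "'h \<Rightarrow> ereal"
    and dual :: "'u \<Rightarrow> ereal"
  assumes L: "bounded_linear L" "L \<noteq> (\<lambda>_. 0)"
    and f: "(\<lambda>x. ereal (f x)) \<in> Gamma0" "\<exists>k. lip_smooth k f"
    and \<rho>: "\<rho> > 0" "strongly_convex \<rho> f"
    and fhat: "fhat = (\<lambda>x. f x - \<rho> / (2 * (onorm L)\<^sup>2) * (norm (L x))\<^sup>2)"
    and \<beta>: "0 < \<beta>" "\<beta> < 1"
    and \<psi>: "(\<lambda>u. ereal (\<psi> u)) \<in> Gamma0" "lip_smooth (1 / \<beta>) \<psi>"
    and T: "T = gradient \<psi>"
    and pos: "\<sigma> > 0" "\<tau> > 0"
    and i: "\<sigma> \<le> \<rho> * \<beta> / ((onorm L)\<^sup>2 * (1 - \<beta>))"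
    and g: "g = (\<lambda>u. ereal (\<sigma> + \<rho> / (onorm L)\<^sup>2) *
                  (fenchel_conj (\<lambda>v. ereal (\<psi> v)) u - ereal (1 / 2 * (norm u)\<^sup>2)))"
    and gcheck: "gcheck = (\<lambda>u. g u + ereal (\<rho> / (2 * (onorm L)\<^sup>2) * (norm u)\<^sup>2))"
    and primal: "primal = (\<lambda>x. ereal (f x) + g (L x))"
    and dual: "dual = (\<lambda>u. fenchel_conj (\<lambda>x. ereal (fhat x)) (- adjoint L u) + fenchel_conj gcheck u)"
  shows "(\<lambda>x. ereal (fhat x)) \<in> Gamma0 \<and> (\<exists>\<kappa>>0. lip_smooth \<kappa> fhat) \<and> gcheck \<in> Gamma0 \<and>
    (\<forall>x. ereal (f x) + g (L x) = ereal (fhat x) + gcheck (L x)) \<and>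
    ((\<exists>x. primal x \<noteq> \<infinity>) \<longrightarrow> primal \<in> Gamma0) \<and>
    (\<forall>\<kappa>>0. lip_smooth \<kappa> fhat \<longrightarrow> \<tau> * (\<sigma> * (onorm L)\<^sup>2 + \<kappa> / 2) < 1 \<longrightarrow>
      (\<forall>(x::nat \<Rightarrow> 'h) (u::nat \<Rightarrow> 'u) (ut::nat \<Rightarrow> 'u).
        (\<forall>k. ut (Suc k) = u k + \<sigma> *\<^sub>R L (x k)) \<longrightarrow>
        (\<forall>k. u (Suc k) = ut (Suc k) - \<sigma> *\<^sub>R T (inverse (\<sigma> + \<rho> / (onorm L)\<^sup>2) *\<^sub>R ut (Suc k))) \<longrightarrow>
        (\<forall>k. x (Suc k) = (x k + (\<tau> * \<rho> / (onorm L)\<^sup>2) *\<^sub>R adjoint L (L (x k)))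
               - \<tau> *\<^sub>R gradient f (x k) - \<tau> *\<^sub>R adjoint L (2 *\<^sub>R u (Suc k) - u k)) \<longrightarrow>
        (\<exists>xs us. minimizer primal xs \<and> minimizer dual us \<and> primal xs = - dual us) \<longrightarrow>
        (\<exists>xh uh. minimizer primal xh \<and> minimizer dual uh \<and>
           weakly_converges x xh \<and> weakly_converges u uh)))"
proof -
  define n where "n = onorm L"
  define r where "r = \<rho> / n\<^sup>2"
  define s where "s = \<sigma> + r"
  have n: "n > 0" using L onorm_pos_lt[OF L(1)] by (auto simp: n_def)
  have r: "r > 0" using \<rho>(1) n by (simp add: r_def)
  have r_half: "\<rho> / (2 * n\<^sup>2) = r / 2" by (simp add: r_def)
  \<comment> \<open>Multiplied out, the bound on \<open>\<sigma>\<close> says that the strong convexity of \<open>s \<psi>\<^sup>*\<close> outweighs \<open>\<sigma> / 2 \<parallel>\<cdot>\<parallel>\<^sup>2\<close>.\<close>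
  have \<sigma>_le: "\<sigma> \<le> s * \<beta>"
  proof -
    have "\<sigma> \<le> r * \<beta> / (1 - \<beta>)" using i by (simp add: r_def n_def)
    then show ?thesis using \<beta> by (simp add: s_def pos_le_divide_eq algebra_simps)
  qed
  have fhat_eq: "fhat = (\<lambda>x. f x - r / 2 * (norm (L x))\<^sup>2)"
    unfolding fhat n_def[symmetric] r_half ..
  obtain k where k: "lip_smooth k f" using f(2) by blast
  note smooth = lip_smooth_minus_norm_square_linear[OF L(1) k less_imp_le[OF r], folded fhat_eq]
  have k_nonneg: "k \<ge> 0" using k by (auto simp: lip_smooth_def lipschitz_on_def)
  have \<kappa>0: "k + r * (onorm L)\<^sup>2 > 0" using k_nonneg r n by (simp add: n_def add_nonneg_pos)
  have fhat_convex: "convex_on UNIV fhat"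
    unfolding fhat_eq r_def n_def
    by (rule convex_on_minus_norm_square_linear[OF L(1) _ \<rho>]) (use n n_def in simp)
  have \<psi>_convex: "convex_on UNIV \<psi>"
    using \<psi>(1) by (simp add: Gamma0_def convex_fun_ereal_iff)
  have s: "s > 0" using pos r by (simp add: s_def)
  have gcheck_eq: "gcheck = weakened_conj s \<sigma> \<psi>"
  proof
    fix u
    show "gcheck u = weakened_conj s \<sigma> \<psi> u"
      using weakened_conj_eq[OF s, of \<psi> u r]
      unfolding gcheck g n_def[symmetric] r_half r_def[symmetric] s_def[symmetric] by (simp add: s_def)
  qed
  have problem: "composite_problem L fhat \<psi> \<beta> \<sigma> s \<kappa>" if "\<kappa> > 0" "lip_smooth \<kappa> fhat" for \<kappa>
    by (rule composite_problem.intro) (use that L(1) fhat_convex \<psi>_convex \<psi>(2) \<beta> pos \<sigma>_le in simp_all)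
  interpret composite_problem L fhat \<psi> \<beta> \<sigma> s "k + r * (onorm L)\<^sup>2"
    by (rule problem[OF \<kappa>0 smooth(2)])
  have split: "ereal (f x) + g (L x) = ereal (fhat x) + gcheck (L x)" for x
    unfolding gcheck fhat by (cases "g (L x)") auto
  have primal_eq: "primal = primal_fun"
    unfolding primal split primal_fun_def gcheck_eq ..
  have dual_eq: "dual = dual_fun"
    unfolding dual dual_fun_def gcheck_eq ..
  have convergence: "\<exists>xh uh. minimizer primal xh \<and> minimizer dual uh \<and> weakly_converges x xh \<and> weakly_converges u uh"
    if \<kappa>: "\<kappa> > 0" "lip_smooth \<kappa> fhat" "\<tau> * (\<sigma> * (onorm L)\<^sup>2 + \<kappa> / 2) < 1"
      and ut: "\<forall>k. ut (Suc k) = u k + \<sigma> *\<^sub>R L (x k)"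
      and u: "\<forall>k. u (Suc k) = ut (Suc k) - \<sigma> *\<^sub>R T (inverse (\<sigma> + \<rho> / (onorm L)\<^sup>2) *\<^sub>R ut (Suc k))"
      and x: "\<forall>k. x (Suc k) = (x k + (\<tau> * \<rho> / (onorm L)\<^sup>2) *\<^sub>R adjoint L (L (x k)))
               - \<tau> *\<^sub>R gradient f (x k) - \<tau> *\<^sub>R adjoint L (2 *\<^sub>R u (Suc k) - u k)"
      and gap: "\<exists>xs us. minimizer primal xs \<and> minimizer dual us \<and> primal xs = - dual us"
    for \<kappa> x u ut
  proof -
    interpret iteration: primal_dual_iteration L fhat \<psi> \<beta> \<sigma> s \<kappa> \<tau> x u
    proof (intro primal_dual_iteration.intro problem \<kappa> primal_dual_iteration_axioms.intro pos)
      show "u (Suc k) = u k + \<sigma> *\<^sub>R L (x k)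
          - \<sigma> *\<^sub>R gradient \<psi> (inverse s *\<^sub>R (u k + \<sigma> *\<^sub>R L (x k)))" for k
        using u ut by (simp add: T s_def r_def n_def)
      have "gradient f (x k) = gradient fhat (x k) + (\<rho> / (onorm L)\<^sup>2) *\<^sub>R adjoint L (L (x k))" for k
        using smooth(1) by (simp add: r_def n_def)
      then show "x (Suc k) = x k - \<tau> *\<^sub>R (gradient fhat (x k) + adjoint L (2 *\<^sub>R u (Suc k) - u k))" for k
        using x by (simp add: scaleR_add_right mult.commute)
    qed
    have "saddle \<noteq> {}"
      using gap no_duality_gap_imp_saddle unfolding primal_eq dual_eq by blast
    then show ?thesis
      using iteration.converges_weakly_to_saddle saddle_imp_minimizers
      unfolding primal_eq dual_eq by blast
  qed
  show ?thesis
  proof (intro conjI)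
    show "(\<lambda>x. ereal (fhat x)) \<in> Gamma0"
      by (rule continuous_convex_in_Gamma0[OF fhat_convex lip_smooth_continuous_on[OF smooth(2)]])
    show "\<exists>\<kappa>>0. lip_smooth \<kappa> fhat" using \<kappa>0 smooth(2) by blast
    show "gcheck \<in> Gamma0" unfolding gcheck_eq by (rule G_in_Gamma0)
    show "\<forall>x. ereal (f x) + g (L x) = ereal (fhat x) + gcheck (L x)" using split by blast
    show "(\<exists>x. primal x \<noteq> \<infinity>) \<longrightarrow> primal \<in> Gamma0" unfolding primal_eq using primal_in_Gamma0 by blast
  qed (use convergence in blast)
qed

end
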